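(* Let $\Delta$ be a $2$-dimensional simplex (a triangle) and let $\Gamma$ be a geometric triangulation of $\Delta$ with vanishing local $h$-polynomial, $\ell(\Gamma;x)=0$. Then $\Gamma$ is obtained, by a finite (possibly empty) sequence of conical facet refinements, either from the trivial subdivision of $\Delta$ or from a triforce subdivision of $\Delta$.
   Context: All triangulations are geometric: a linearly embedded simplex is subdivided into linearly embedded subsimplices forming a simplicial complex. For a triangulation $\Gamma$ of a $(d-1)$-simplex $\Delta$ and a face $F$ of $\Delta$ (possibly empty, possibly $\Delta$ itself), $\Gamma_F$ denotes the restriction of $\Gamma$ to $F$. The $h$-polynomial $h(\Gamma;x)=\sum_{i=0}^d h_ix^i$ of a triangulation $\Gamma$ of a $(d-1)$-simplex is defined by $\sum_{i=0}^d h_i(x+1)^{d-i}=\sum_{i=0}^d f_{i-1}x^{d-i}$, where $f_{-1}=1$ and $f_i$ is the number of $i$-dimensional faces of $\Gamma$; the triangulation of the empty face has $h=1$. The local $h$-polynomial is $\ell(\Gamma;x)=\sum_{F\le \Delta}(-1)^{d-1-\dim F}h(\Gamma_F;x)$, the sum over all faces $F$ of $\Delta$ including the empty face (of dimension $-1$). The trivial subdivision of a simplex consists of the simplex and all its faces. A triangulation $\Gamma'$ is a refinement of $\Gamma$ if every face of $\Gamma$ is a union of faces of $\Gamma'$. If $G$ is a facet (maximal face) of $\Gamma$, a refinement $\Gamma'$ is a facet refinement of $\Gamma$ along $G$ if for every facet $H\neq G$ of $\Gamma$ the restriction $\Gamma'_H$ is the trivial subdivision of $H$. It is a conical facet refinement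 if moreover $\Gamma'_G$ is the cone over $\Gamma'_H$ (with apex the opposite vertex of $G$) for some codimension-1 face $H$ of $G$. A triforce subdivision of a triangle with vertices $a,b,c$ is the triangulation obtained by choosing one point in the relative interior of each of the three edges, say $p\in(b,c)$, $q\in(a,c)$, $r\in(a,b)$, and taking the four triangles $\mathrm{conv}(a,r,q)$, $\mathrm{conv}(b,p,r)$, $\mathrm{conv}(c,q,p)$, $\mathrm{conv}(p,q,r)$ together with all their faces. *)

theory Defs
  imports "HOL-Analysis.Analysis" "HOL-Computational_Algebra.Polynomial"
begin

text \<open>The empty set is a simplex of dimension -1 here and a face of every simplex, as it is for
  \<^const>\<open>simplex\<close> and \<^const>\<open>face_of\<close>; the requirement \<open>{} \<in> \<Gamma>\<close> only matters
  when \<open>\<Delta>\<close> itself is empty, and gives \<open>f\<^sub>-\<^sub>1 = 1\<close>.\<close>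

definition triangulates :: "'a::euclidean_space set set \<Rightarrow> 'a set \<Rightarrow> bool" where
  "triangulates \<Gamma> \<Delta> \<longleftrightarrow> simplicial_complex \<Gamma> \<and> \<Union>\<Gamma> = \<Delta> \<and> {} \<in> \<Gamma>"

definition restriction :: "'a set set \<Rightarrow> 'a set \<Rightarrow> 'a set set" where
  "restriction \<Gamma> F = {S \<in> \<Gamma>. S \<subseteq> F}"

definition trivial_subdivision :: "'a::euclidean_space set \<Rightarrow> 'a set set" where
  "trivial_subdivision \<Delta> = {F. F face_of \<Delta>}"

definition num_faces :: "'a::euclidean_space set set \<Rightarrow> int \<Rightarrow> nat" where
  "num_faces \<Gamma> i = card {S \<in> \<Gamma>. aff_dim S = i}"

text \<open>The defining equation of the h-polynomial, for a triangulation of a (d-1)-simplex,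
  as an identity of polynomials in x.\<close>

definition is_h_poly :: "nat \<Rightarrow> 'a::euclidean_space set set \<Rightarrow> int poly \<Rightarrow> bool" where
  "is_h_poly d \<Gamma> h \<longleftrightarrow> degree h \<le> d \<and>
     (\<Sum>i\<le>d. smult (coeff h i) ([:1, 1:] ^ (d - i))) =
     (\<Sum>i\<le>d. monom (int (num_faces \<Gamma> (int i - 1))) (d - i))"

lemma is_h_poly_ex1: "\<exists>!h. is_h_poly d \<Gamma> h"
proof -
  define p :: "int poly" where "p = (\<Sum>i\<le>d. monom (int (num_faces \<Gamma> (int i - 1))) (d - i))"
  define q where "q = pcompose p [:-1, 1:]"
  have comp: "pcompose [:1, 1:] [:-1, 1:] = ([:0, 1:] :: int poly)"
    "pcompose [:-1, 1:] [:1, 1:] = ([:0, 1:] :: int poly)"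
    by (simp_all add: pcompose_pCons)
  have power: "pcompose (r ^ n) s = pcompose r s ^ n" for r s :: "int poly" and n
    by (induction n) (simp_all add: pcompose_mult pcompose_1)
  have id: "pcompose (pcompose r [:-1, 1:]) [:1, 1:] = r"
    "pcompose (pcompose r [:1, 1:]) [:-1, 1:] = r" for r :: "int poly"
    by (simp_all add: pcompose_assoc [symmetric] comp)
  have mono: "smult c ([:0, 1:] ^ n) = monom c n" for c :: int and n
    by (simp add: monom_altdef)
  have sum_rev: "(\<Sum>i\<le>d. monom (coeff h i) (d - i)) = (\<Sum>i\<le>d. monom (coeff h (d - i)) i)"
    for h :: "int poly"
    by (rule sum.reindex_bij_witness[of _ "\<lambda>i. d - i" "\<lambda>i. d - i"]) auto
  have equiv: "is_h_poly d \<Gamma> h \<longleftrightarrow> degree h \<le> d \<and> (\<Sum>i\<le>d. monom (coeff h (d - i)) i) = q"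
    (is "_ \<longleftrightarrow> _ \<and> ?s = q") for h
  proof -
    have 1: "pcompose ?s [:1, 1:] = (\<Sum>i\<le>d. smult (coeff h i) ([:1, 1:] ^ (d - i)))"
      unfolding sum_rev [symmetric]
      by (simp add: pcompose_sum mono [symmetric] pcompose_smult power
          pcompose_pCons)
    have "?s = q \<longleftrightarrow> pcompose ?s [:1, 1:] = p"
    proof
      assume "?s = q"
      then show "pcompose ?s [:1, 1:] = p" by (simp only: q_def id)
    next
      assume "pcompose ?s [:1, 1:] = p"
      then show "?s = q" using id(2)[of ?s] by (simp only: q_def)
    qed
    then show ?thesis unfolding is_h_poly_def 1 p_def by simp
  qed
  have coeff_s: "coeff (\<Sum>i\<le>d. monom (f i) i) n = (if n \<le> d then f n else 0)"
    for f :: "nat \<Rightarrow> int" and n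
    by (simp add: coeff_sum)
  have degp: "degree p \<le> d" unfolding p_def
    by (rule degree_sum_le) (auto intro: order.trans[OF degree_monom_le])
  have degq: "degree q \<le> d"
    using degp by (simp add: q_def degree_pcompose)
  have ex: "\<exists>h. is_h_poly d \<Gamma> h"
  proof
    let ?h = "\<Sum>i\<le>d. monom (coeff q (d - i)) i"
    have "degree ?h \<le> d"
      by (rule degree_sum_le) (auto intro: order.trans[OF degree_monom_le])
    moreover have "(\<Sum>i\<le>d. monom (coeff ?h (d - i)) i) = q"
      using degq by (intro poly_eqI) (auto simp: coeff_s coeff_eq_0)
    ultimately show "is_h_poly d \<Gamma> ?h" unfolding equiv by blast
  qed
  have uniq: "h = h'" if "is_h_poly d \<Gamma> h" "is_h_poly d \<Gamma> h'" for h h'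
  proof (rule poly_eqI)
    fix n
    have eq: "(\<Sum>i\<le>d. monom (coeff h (d - i)) i) = (\<Sum>i\<le>d. monom (coeff h' (d - i)) i)"
      and deg: "degree h \<le> d" "degree h' \<le> d"
      using that unfolding equiv by auto
    have "coeff h (d - (d - n)) = coeff h' (d - (d - n))"
      using arg_cong[OF eq, of "\<lambda>r. coeff r (d - n)"] by (simp add: coeff_s)
    then show "coeff h n = coeff h' n"
      using deg by (cases "n \<le> d") (auto simp: coeff_eq_0)
  qed
  show ?thesis using ex uniq by blast
qed

definition h_poly :: "'a::euclidean_space set \<Rightarrow> 'a set set \<Rightarrow> int poly" where
  "h_poly \<Delta> \<Gamma> = (THE h. is_h_poly (nat (aff_dim \<Delta> + 1)) \<Gamma> h)"

lemma is_h_poly_h_poly: "is_h_poly (nat (aff_dim \<Delta> + 1)) \<Gamma> (h_poly \<Delta> \<Gamma>)"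
  unfolding h_poly_def by (rule theI', rule is_h_poly_ex1)

definition local_h_poly :: "'a::euclidean_space set \<Rightarrow> 'a set set \<Rightarrow> int poly" where
  "local_h_poly \<Delta> \<Gamma> =
     (\<Sum>F | F face_of \<Delta>. (-1) ^ nat (aff_dim \<Delta> - aff_dim F) * h_poly F (restriction \<Gamma> F))"

definition is_facet :: "'a set set \<Rightarrow> 'a set \<Rightarrow> bool" where
  "is_facet \<Gamma> G \<longleftrightarrow> G \<in> \<Gamma> \<and> (\<forall>S\<in>\<Gamma>. G \<subseteq> S \<longrightarrow> S = G)"

definition refinement :: "'a::euclidean_space set \<Rightarrow> 'a set set \<Rightarrow> 'a set set \<Rightarrow> bool" where
  "refinement \<Delta> \<Gamma> \<Gamma>' \<longleftrightarrow> triangulates \<Gamma> \<Delta> \<and> triangulates \<Gamma>' \<Delta> \<and>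
     (\<forall>S\<in>\<Gamma>. \<exists>\<A>\<subseteq>\<Gamma>'. S = \<Union>\<A>)"

definition facet_refinement ::
    "'a::euclidean_space set \<Rightarrow> 'a set \<Rightarrow> 'a set set \<Rightarrow> 'a set set \<Rightarrow> bool" where
  "facet_refinement \<Delta> G \<Gamma> \<Gamma>' \<longleftrightarrow> refinement \<Delta> \<Gamma> \<Gamma>' \<and> is_facet \<Gamma> G \<and>
     (\<forall>H. is_facet \<Gamma> H \<and> H \<noteq> G \<longrightarrow> restriction \<Gamma>' H = trivial_subdivision H)"

text \<open>Since \<open>{}\<close> belongs to the base, the apex \<open>{v}\<close> is one of the faces of the cone.\<close>

definition cone_over :: "'a::euclidean_space \<Rightarrow> 'a set set \<Rightarrow> 'a set set" where
  "cone_over v K = K \<union> (\<lambda>S. convex hull (insert v S)) ` K"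

text \<open>The codimension-1 face \<open>H\<close> is not expressed by \<^const>\<open>facet_of\<close>, which excludes the
  empty face of a point.\<close>

definition conical_facet_refinement ::
    "'a::euclidean_space set \<Rightarrow> 'a set set \<Rightarrow> 'a set set \<Rightarrow> bool" where
  "conical_facet_refinement \<Delta> \<Gamma> \<Gamma>' \<longleftrightarrow>
     (\<exists>G H v. facet_refinement \<Delta> G \<Gamma> \<Gamma>' \<and> H face_of G \<and> aff_dim H = aff_dim G - 1 \<and>
        v extreme_point_of G \<and> v \<notin> H \<and>
        restriction \<Gamma>' G = cone_over v (restriction \<Gamma>' H))"

definition triforce_subdivision :: "'a::euclidean_space set \<Rightarrow> 'a set set \<Rightarrow> bool" where
  "triforce_subdivision \<Delta> \<Gamma> \<longleftrightarrow>
     (\<exists>a b c p q r. card {a, b, c} = 3 \<and> \<not> affine_dependent {a, b, c} \<and>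
        \<Delta> = convex hull {a, b, c} \<and>
        p \<in> open_segment b c \<and> q \<in> open_segment a c \<and> r \<in> open_segment a b \<and>
        \<Gamma> = {F. \<exists>T \<in> {convex hull {a, r, q}, convex hull {b, p, r},
                        convex hull {c, q, p}, convex hull {p, q, r}}. F face_of T})"

end

theory Submission
  imports Defs
begin

text \<open>The coefficient of \<open>x\<close> in the local h-polynomial is the number of interior vertices, so all
  vertices lie on the boundary. As a side with \<open>n\<close> vertices has at most \<open>n - 1\<close> edges, the
  coefficients of \<open>x\<^sup>2\<close> and \<open>x\<^sup>3\<close> then give \<open>f\<^sub>2 + 2 \<le> f\<^sub>0\<close>. A vertex in the relative interior of a
  side lies in at least two triangles. If it lies in exactly two, then these merge into one
  triangle, of which they are a conical refinement, and both conditions persist. If no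
  vertex can be removed this way, counting incidences of vertices and triangles gives
  \<open>3 f\<^sub>2 \<ge> 3 (f\<^sub>0 - 3) + 3\<close>, hence equality: every corner lies in exactly one triangle and every
  other vertex in exactly three. Following these triangles along from a corner closes up at once, in the
  trivial subdivision or a triforce.\<close>

section \<open>Segments and convex hulls\<close>

text \<open>The hypothesis only provides a simplicial complex with union \<open>\<Delta>\<close>;
  nothing is given about how triangles fit together. Purity, the second triangle at an inner edge
  and the uniqueness of the triangle at a boundary edge therefore have to come from convexity. Faces
  are represented by their vertex sets, which turns intersection and inclusion of faces into plain
  set operations.

  The x^3 coefficient reads f_2 = f_1 - f_0 + 1. In the x^2 coefficient a side with n vertices and e
  edges contributes n - 1 - e >= 0, so f_1 <= 2 f_0 - 3. This takes the place of Euler's formula and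
  of the fact that a side is subdivided into a path. The resulting inequality, and not the vanishing
  of the local h-polynomial, is what the induction carries: a merge lowers f_0 by one and f_2 by at
  least one, so no h-polynomial has to be recomputed.\<close>

lemma convex_hull_inj_affine_independent:
  fixes A B :: "'a::euclidean_space set"
  assumes "\<not> affine_dependent A" "\<not> affine_dependent B" "convex hull A = convex hull B"
  shows "A = B"
proof (rule set_eqI)
  fix x show "x \<in> A \<longleftrightarrow> x \<in> B"
    using extreme_point_of_convex_hull_affine_independent[OF assms(1), of x]
      extreme_point_of_convex_hull_affine_independent[OF assms(2), of x] assms(3) by simp
qed

text \<open>The intersection is a face of the simplex, hence the hull of some
  \<open>D \<subseteq> S\<close>; by independence a point of \<open>S\<close> lies in the hull of a
  subset only if it belongs to that subset.\<close>

lemma convex_hull_Int_affine_independent: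
  fixes S :: "'a::euclidean_space set"
  assumes S: "\<not> affine_dependent S" and sub: "A \<subseteq> S" "B \<subseteq> S"
  shows "convex hull A \<inter> convex hull B = convex hull (A \<inter> B)"
proof
  have "convex hull A face_of convex hull S" "convex hull B face_of convex hull S"
    using sub by (auto simp: face_of_convex_hull_affine_independent[OF S])
  then have "convex hull A \<inter> convex hull B face_of convex hull S"
    by (rule face_of_Int)
  then obtain D where D: "D \<subseteq> S" "convex hull A \<inter> convex hull B = convex hull D"
    by (auto simp: face_of_convex_hull_affine_independent[OF S])
  have mem: "d \<in> C" if "d \<in> D" "C \<subseteq> S" "d \<in> convex hull C" for d C
  proof (rule ccontr)
    assume "d \<notin> C"
    then have "C \<subseteq> S - {d}" using that by auto
    then have "d \<in> affine hull (S - {d})"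
      using that(3) convex_hull_subset_affine_hull hull_mono by blast
    then show False using S that D(1) unfolding affine_dependent_def by blast
  qed
  have "D \<subseteq> convex hull A \<inter> convex hull B" unfolding D(2) by (rule hull_subset)
  then have "D \<subseteq> A \<inter> B" using mem[OF _ sub(1)] mem[OF _ sub(2)] by auto
  then show "convex hull A \<inter> convex hull B \<subseteq> convex hull (A \<inter> B)"
    unfolding D(2) by (rule hull_mono)
qed (simp add: hull_mono)

lemma affine_independent_subset:
  "\<not> affine_dependent A \<Longrightarrow> B \<subseteq> A \<Longrightarrow> \<not> affine_dependent B"
  using affine_dependent_subset by blast

lemma closed_segment_cases:
  fixes v :: "'a::euclidean_space"
  assumes "v \<in> closed_segment b c" "x \<in> closed_segment b c"
  shows "x \<in> closed_segment v b \<or> x \<in> closed_segment v c"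
  using Un_closed_segment[OF assms(1)] assms(2) by (auto simp: closed_segment_commute)

lemma closed_segment_meet:
  fixes v :: "'a::euclidean_space"
  assumes "v \<in> closed_segment b c" "x \<in> closed_segment v b" "x \<in> closed_segment v c"
  shows "x = v"
  using Int_closed_segment[of v b c] assms by (auto simp: closed_segment_commute)

text \<open>The points of a segment are ordered by their distance from \<open>b\<close>. This gives
  every edge inside a side an end far from \<open>b\<close>, which is how edges get counted.\<close>

lemma closed_segment_linear:
  fixes b :: "'a::euclidean_space"
  assumes "u \<in> closed_segment b c" "w \<in> closed_segment b c"
  shows "u \<in> closed_segment w b \<or> w \<in> closed_segment u b"
proof -
  have *: "u \<in> closed_segment w b"
    if "u = b + s *\<^sub>R (c - b)" "w = b + t *\<^sub>R (c - b)" "0 \<le> s" "s \<le> t" for u w s t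
  proof (cases "t = 0")
    case True
    then show ?thesis using that by simp
  next
    case False
    then have "u = (1 - (1 - s / t)) *\<^sub>R w + (1 - s / t) *\<^sub>R b"
      unfolding that(1,2) using False by (simp add: algebra_simps)
    moreover have "0 \<le> 1 - s / t" "1 - s / t \<le> 1" using False that by auto
    ultimately show ?thesis unfolding in_segment by blast
  qed
  obtain s where s: "0 \<le> s" "u = b + s *\<^sub>R (c - b)"
    using assms(1) by (auto simp: in_segment algebra_simps)
  obtain t where t: "0 \<le> t" "w = b + t *\<^sub>R (c - b)"
    using assms(2) by (auto simp: in_segment algebra_simps)
  show ?thesis using *[OF s(2) t(2) s(1)] *[OF t(2) s(2) t(1)] by linarith
qed

text \<open>By the exchange property, a point of the hull stays in the hull when \<open>v\<close>
  replaces one suitable vertex.\<close>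

lemma convex_hull_split:
  fixes w p q v :: "'a::euclidean_space"
  assumes v: "v \<in> closed_segment p q"
  shows "convex hull {w, p, q} = convex hull {v, w, p} \<union> convex hull {v, w, q}"
proof
  have vh: "v \<in> convex hull {w, p, q}"
    using v hull_mono[of "{p, q}" "{w, p, q}" convex] by (auto simp: segment_convex_hull)
  then have "{v, w, p} \<subseteq> convex hull {w, p, q}" "{v, w, q} \<subseteq> convex hull {w, p, q}"
    using hull_subset[of "{w, p, q}" convex] by auto
  then show "convex hull {v, w, p} \<union> convex hull {v, w, q} \<subseteq> convex hull {w, p, q}"
    by (intro Un_least hull_minimal convex_convex_hull)
  show "convex hull {w, p, q} \<subseteq> convex hull {v, w, p} \<union> convex hull {v, w, q}"
  proof
    fix x assume "x \<in> convex hull {w, p, q}"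
    then obtain r where r: "r \<in> {w, p, q}" "x \<in> convex hull (insert v ({w, p, q} - {r}))"
      using in_convex_hull_exchange[OF vh] by metis
    consider "r = w" | "r = p" | "r = q" using r(1) by blast
    then show "x \<in> convex hull {v, w, p} \<union> convex hull {v, w, q}"
    proof cases
      \<comment> \<open>Replacing \<open>w\<close> leads to neither of the two small triangles; but
        here the point lies on the segment from \<open>p\<close> to \<open>q\<close>, and
        \<open>v\<close> cuts that segment in two.\<close>
      case 1
      then have "x \<in> convex hull (insert v {p, q})"
        using r(2) hull_mono[of "insert v ({w, p, q} - {r})" "insert v {p, q}" convex] by blast
      moreover have "convex hull (insert v {p, q}) = convex hull {p, q}"
        using v by (intro hull_redundant) (simp add: segment_convex_hull)
      ultimately have "x \<in> closed_segment p q" by (simp add: segment_convex_hull)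
      then have "x \<in> convex hull {v, p} \<or> x \<in> convex hull {v, q}"
        using closed_segment_cases[OF v] by (simp add: segment_convex_hull)
      then show ?thesis
        using hull_mono[of "{v, p}" "{v, w, p}" convex] hull_mono[of "{v, q}" "{v, w, q}" convex] by blast
    next
      case 2
      then show ?thesis
        using r(2) hull_mono[of "insert v ({w, p, q} - {r})" "{v, w, q}" convex] by blast
    next
      case 3
      then show ?thesis
        using r(2) hull_mono[of "insert v ({w, p, q} - {r})" "{v, w, p}" convex] by blast
    qed
  qed
qed

lemma between_rays:
  fixes v :: "'a::euclidean_space"
  assumes v: "v \<in> open_segment b c" and p: "p \<in> closed_segment v b" "p \<noteq> v"
    and q: "q \<in> closed_segment v c" "q \<noteq> v"
  shows "v \<in> closed_segment p q"
proof -
  obtain r where r: "0 < r" "r < 1" "v = (1 - r) *\<^sub>R b + r *\<^sub>R c" using v by (auto simp: in_segment)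
  obtain s where s: "0 \<le> s" "p = (1 - s) *\<^sub>R v + s *\<^sub>R b" using p(1) by (auto simp: in_segment)
  obtain t where t: "0 \<le> t" "q = (1 - t) *\<^sub>R v + t *\<^sub>R c" using q(1) by (auto simp: in_segment)
  \<comment> \<open>These are the distances of \<open>p\<close> and \<open>q\<close> from
    \<open>v\<close>, in opposite directions and in units of \<open>c - b\<close>; the weight
    \<open>\<sigma> / (\<sigma> + \<tau>)\<close> makes them cancel.\<close>
  define \<sigma> \<tau> where "\<sigma> = s * r" and "\<tau> = t * (1 - r)"
  have "s \<noteq> 0" "t \<noteq> 0" using p q s t by auto
  then have pos: "0 < \<sigma>" "0 < \<tau>" using s t r by (auto simp: \<sigma>_def \<tau>_def)
  have b: "b - v = (- r) *\<^sub>R (c - b)" and c: "c - v = (1 - r) *\<^sub>R (c - b)"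
    by (simp_all add: r(3) algebra_simps)
  have "p = v + s *\<^sub>R (b - v)" by (simp add: s algebra_simps)
  then have p_eq: "p = v - \<sigma> *\<^sub>R (c - b)" unfolding b by (simp add: \<sigma>_def)
  have "q = v + t *\<^sub>R (c - v)" by (simp add: t algebra_simps)
  then have q_eq: "q = v + \<tau> *\<^sub>R (c - b)" unfolding c by (simp add: \<tau>_def)
  have "(1 - \<sigma> / (\<sigma> + \<tau>)) *\<^sub>R p + (\<sigma> / (\<sigma> + \<tau>)) *\<^sub>R q
      = v + (\<sigma> / (\<sigma> + \<tau>) * \<tau> - (1 - \<sigma> / (\<sigma> + \<tau>)) * \<sigma>) *\<^sub>R (c - b)"
    unfolding p_eq q_eq by (simp add: algebra_simps)
  also have "\<sigma> / (\<sigma> + \<tau>) * \<tau> - (1 - \<sigma> / (\<sigma> + \<tau>)) * \<sigma> = 0"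
    using pos by (simp add: field_simps)
  finally have "v = (1 - \<sigma> / (\<sigma> + \<tau>)) *\<^sub>R p + (\<sigma> / (\<sigma> + \<tau>)) *\<^sub>R q" by simp
  moreover have "0 \<le> \<sigma> / (\<sigma> + \<tau>)" "\<sigma> / (\<sigma> + \<tau>) \<le> 1" using pos by auto
  ultimately show ?thesis unfolding in_segment by blast
qed

section \<open>Simplicial complexes by vertex sets\<close>

text \<open>The geometric axioms reduced to conditions on vertex sets; the inclusion opposite to the
  last one holds by monotonicity of the hull. The merged triangulation is built this way.\<close>

lemma simplicial_complexI:
  fixes K :: "'a::euclidean_space set set"
  assumes fin: "finite K"
    and indep: "\<And>A. A \<in> K \<Longrightarrow> \<not> affine_dependent A"
    and sub: "\<And>A B. A \<in> K \<Longrightarrow> B \<subseteq> A \<Longrightarrow> B \<in> K"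
    and int: "\<And>A B. A \<in> K \<Longrightarrow> B \<in> K \<Longrightarrow> convex hull A \<inter> convex hull B \<subseteq> convex hull (A \<inter> B)"
  shows "simplicial_complex ((hull) convex ` K)"
  unfolding simplicial_complex_def
proof (intro conjI ballI allI impI)
  show "finite ((hull) convex ` K)" using fin by simp
next
  fix S assume "S \<in> (hull) convex ` K"
  then obtain A where A: "A \<in> K" "S = convex hull A" by auto
  then have "(int (card A) - 1) simplex S"
    using indep by (auto simp: simplex_def)
  then show "\<exists>n. n simplex S" ..
next
  fix F S assume "S \<in> (hull) convex ` K \<and> F face_of S"
  then show "F \<in> (hull) convex ` K"
    using indep sub by (auto simp: face_of_convex_hull_affine_independent)
next
  fix S S' assume "S \<in> (hull) convex ` K \<and> S' \<in> (hull) convex ` K"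
  then obtain A B where AB: "A \<in> K" "S = convex hull A" "B \<in> K" "S' = convex hull B" by auto
  have "S \<inter> S' = convex hull (A \<inter> B)"
    using int[OF AB(1,3)] AB by (auto intro: hull_mono[THEN subsetD])
  then show "S \<inter> S' face_of S"
    using AB indep by (auto simp: face_of_convex_hull_affine_independent)
qed

definition face_sets :: "'a::euclidean_space set set \<Rightarrow> 'a set set" where
  "face_sets \<Gamma> = {A. \<not> affine_dependent A \<and> convex hull A \<in> \<Gamma>}"

definition vertices :: "'a::euclidean_space set set \<Rightarrow> 'a set" where
  "vertices \<Gamma> = {v. {v} \<in> \<Gamma>}"

definition triangles :: "'a::euclidean_space set set \<Rightarrow> 'a set set" where
  "triangles \<Gamma> = {A \<in> face_sets \<Gamma>. card A = 3}"

definition triangles_at :: "'a::euclidean_space set set \<Rightarrow> 'a \<Rightarrow> 'a set set" where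
  "triangles_at \<Gamma> v = {A \<in> triangles \<Gamma>. v \<in> A}"

lemma inj_on_hull_face_sets: "inj_on ((hull) convex) (face_sets \<Gamma>)"
  by (rule inj_onI, rule convex_hull_inj_affine_independent) (auto simp: face_sets_def)

context
  fixes \<Gamma> :: "'a::euclidean_space set set"
  assumes complex: "simplicial_complex \<Gamma>"
begin

lemma hull_image_face_sets: "(hull) convex ` face_sets \<Gamma> = \<Gamma>"
proof
  show "\<Gamma> \<subseteq> (hull) convex ` face_sets \<Gamma>"
  proof
    fix S assume S: "S \<in> \<Gamma>"
    then obtain n where "n simplex S" using complex unfolding simplicial_complex_def by blast
    then obtain C where "\<not> affine_dependent C" "S = convex hull C"
      unfolding simplex_def by blast
    then show "S \<in> (hull) convex ` face_sets \<Gamma>" using S by (auto simp: face_sets_def)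
  qed
qed (auto simp: face_sets_def)

lemma finite_face_sets: "finite (face_sets \<Gamma>)"
proof -
  have "finite \<Gamma>" using complex by (simp add: simplicial_complex_def)
  then have "finite ((hull) convex ` face_sets \<Gamma>)" by (simp add: hull_image_face_sets)
  then show ?thesis by (rule finite_imageD) (rule inj_on_hull_face_sets)
qed

lemma finite_vertices: "finite (vertices \<Gamma>)"
proof -
  have "finite \<Gamma>" using complex by (simp add: simplicial_complex_def)
  moreover have "(\<lambda>v. {v}) ` vertices \<Gamma> \<subseteq> \<Gamma>" by (auto simp: vertices_def)
  ultimately have "finite ((\<lambda>v. {v}) ` vertices \<Gamma>)" by (rule rev_finite_subset)
  then show ?thesis by (rule finite_imageD) (simp add: inj_on_def)
qed

lemma finite_triangles: "finite (triangles \<Gamma>)"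
  using finite_face_sets by (simp add: triangles_def)

lemma face_setsE:
  assumes "S \<in> \<Gamma>" obtains A where "A \<in> face_sets \<Gamma>" "S = convex hull A"
  using assms hull_image_face_sets by blast

lemma face_sets_subset:
  assumes "A \<in> face_sets \<Gamma>" "B \<subseteq> A"
  shows "B \<in> face_sets \<Gamma>"
proof -
  have A: "\<not> affine_dependent A" "convex hull A \<in> \<Gamma>" using assms(1) by (auto simp: face_sets_def)
  have "convex hull B face_of convex hull A"
    using assms(2) by (auto simp: face_of_convex_hull_affine_independent[OF A(1)])
  then have "convex hull B \<in> \<Gamma>" using complex A(2) unfolding simplicial_complex_def by blast
  then show ?thesis using affine_independent_subset[OF A(1) assms(2)] by (simp add: face_sets_def)
qed

lemma face_sets_singleton: "{v} \<in> face_sets \<Gamma> \<longleftrightarrow> v \<in> vertices \<Gamma>"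
  by (auto simp: face_sets_def vertices_def)

lemma face_sets_vertices: "A \<in> face_sets \<Gamma> \<Longrightarrow> A \<subseteq> vertices \<Gamma>"
  using face_sets_subset[of A] face_sets_singleton by auto

text \<open>The intersection is a face of both hulls, so it is spanned by a subset of
  \<open>A\<close> and by a subset of \<open>B\<close>; these agree because a simplex determines its
  vertices.\<close>

lemma face_sets_Int:
  assumes "A \<in> face_sets \<Gamma>" "B \<in> face_sets \<Gamma>"
  shows "convex hull A \<inter> convex hull B = convex hull (A \<inter> B)"
proof -
  have *: "\<exists>C\<subseteq>A'. convex hull A' \<inter> convex hull B' = convex hull C"
    if "A' \<in> face_sets \<Gamma>" "B' \<in> face_sets \<Gamma>" for A' B'
  proof -
    have A: "\<not> affine_dependent A'" "convex hull A' \<in> \<Gamma>" "convex hull B' \<in> \<Gamma>"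
      using that by (auto simp: face_sets_def)
    then have "convex hull A' \<inter> convex hull B' face_of convex hull A'"
      using complex unfolding simplicial_complex_def by blast
    then show ?thesis using face_of_convex_hull_affine_independent[OF A(1)] by blast
  qed
  obtain C where C: "C \<subseteq> A" "convex hull A \<inter> convex hull B = convex hull C"
    using * assms by blast
  obtain D where D: "D \<subseteq> B" "convex hull A \<inter> convex hull B = convex hull D"
    using *[OF assms(2,1)] by (auto simp: Int_commute)
  have "C = D"
  proof (rule convex_hull_inj_affine_independent)
    show "\<not> affine_dependent C" "\<not> affine_dependent D"
      using assms affine_independent_subset[of A C] affine_independent_subset[of B D] C D
      by (auto simp: face_sets_def)
    show "convex hull C = convex hull D" using C(2) D(2) by simp
  qed
  then have "C \<subseteq> A \<inter> B" using C D by auto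
  then have "convex hull A \<inter> convex hull B \<subseteq> convex hull (A \<inter> B)" unfolding C(2) by (rule hull_mono)
  then show ?thesis using hull_mono[of "A \<inter> B" A convex] hull_mono[of "A \<inter> B" B convex] by blast
qed

lemma vertex_in_hull:
  assumes "A \<in> face_sets \<Gamma>" "v \<in> vertices \<Gamma>" "v \<in> convex hull A"
  shows "v \<in> A"
proof -
  have "convex hull {v} \<inter> convex hull A = convex hull ({v} \<inter> A)"
    using assms face_sets_Int face_sets_singleton by blast
  then show ?thesis using assms(3) by (cases "v \<in> A") auto
qed

text \<open>\<open>convex hull (A \<inter> B)\<close> is a face of \<open>convex hull A\<close> that
  meets its relative interior, and only the whole simplex is such a face. Most inclusions between
  faces are derived from a single point in this way.\<close>

lemma face_sets_subsetI:
  assumes A: "A \<in> face_sets \<Gamma>" and B: "B \<in> face_sets \<Gamma>"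
    and x: "x \<in> rel_interior (convex hull A)" "x \<in> convex hull B"
  shows "A \<subseteq> B"
proof -
  have "convex hull (A \<inter> B) face_of convex hull A"
    using A by (auto simp: face_of_convex_hull_affine_independent face_sets_def)
  moreover have "x \<in> convex hull (A \<inter> B)"
    using face_sets_Int[OF A B] x rel_interior_subset by blast
  ultimately have "convex hull (A \<inter> B) = convex hull A"
    using x(1) face_of_disjoint_rel_interior by blast
  then have "A \<inter> B = A"
  proof (rule convex_hull_inj_affine_independent[rotated 2])
    show A': "\<not> affine_dependent A" using A by (simp add: face_sets_def)
    show "\<not> affine_dependent (A \<inter> B)" by (rule affine_independent_subset[OF A']) simp
  qed
  then show ?thesis by auto
qed

lemma num_faces_eq: "num_faces \<Gamma> (int n - 1) = card {A \<in> face_sets \<Gamma>. card A = n}"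
proof -
  have "{S \<in> \<Gamma>. aff_dim S = int n - 1} = (hull) convex ` {A \<in> face_sets \<Gamma>. card A = n}"
  proof -
    have "aff_dim (convex hull A) = int n - 1 \<longleftrightarrow> card A = n" if "A \<in> face_sets \<Gamma>" for A
      using that aff_dim_affine_independent[of A]
      by (auto simp: face_sets_def aff_dim_convex_hull)
    then have "{S \<in> (hull) convex ` face_sets \<Gamma>. aff_dim S = int n - 1} = (hull) convex ` {A \<in> face_sets \<Gamma>. card A = n}"
      by auto
    then show ?thesis by (simp add: hull_image_face_sets)
  qed
  moreover have "inj_on ((hull) convex) {A \<in> face_sets \<Gamma>. card A = n}"
    using inj_on_hull_face_sets by (rule inj_on_subset) auto
  ultimately show ?thesis by (simp add: num_faces_def card_image)
qed

lemma num_faces_0: "num_faces \<Gamma> 0 = card (vertices \<Gamma>)"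
proof -
  have "{A \<in> face_sets \<Gamma>. card A = Suc 0} = (\<lambda>v. {v}) ` vertices \<Gamma>"
    by (auto simp: card_Suc_eq face_sets_singleton)
  then show ?thesis using num_faces_eq[of 1] by (simp add: card_image)
qed

lemma num_faces_2: "num_faces \<Gamma> 2 = card (triangles \<Gamma>)"
  using num_faces_eq[of 3] by (simp add: triangles_def)

lemma complex_restriction: "simplicial_complex (restriction \<Gamma> F)"
  unfolding simplicial_complex_def restriction_def
proof (intro conjI ballI allI impI)
  show "finite {S \<in> \<Gamma>. S \<subseteq> F}" using complex by (simp add: simplicial_complex_def)
next
  fix S assume "S \<in> {S \<in> \<Gamma>. S \<subseteq> F}"
  then show "\<exists>n. n simplex S" using complex unfolding simplicial_complex_def by blast
next
  fix S' S assume S: "S \<in> {S \<in> \<Gamma>. S \<subseteq> F} \<and> S' face_of S"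
  then have "S' \<subseteq> S" "S' \<in> \<Gamma>"
    using complex face_of_imp_subset[of S' S] unfolding simplicial_complex_def by blast+
  then show "S' \<in> {S \<in> \<Gamma>. S \<subseteq> F}" using S by auto
next
  fix S S' assume "S \<in> {S \<in> \<Gamma>. S \<subseteq> F} \<and> S' \<in> {S \<in> \<Gamma>. S \<subseteq> F}"
  then show "S \<inter> S' face_of S" using complex unfolding simplicial_complex_def by blast
qed

end

section \<open>Triangulations of a triangle\<close>

locale triangulated_triangle =
  fixes \<Delta> :: "'a::euclidean_space set" and \<Gamma> :: "'a set set"
  assumes simplex: "2 simplex \<Delta>" and triangulates: "triangulates \<Gamma> \<Delta>"
begin

lemma complex: "simplicial_complex \<Gamma>" and Union_eq: "\<Union>\<Gamma> = \<Delta>"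
  using triangulates by (auto simp: triangulates_def)

lemma finite_complex: "finite \<Gamma>"
  using complex by (simp add: simplicial_complex_def)

lemma closed_face: "S \<in> \<Gamma> \<Longrightarrow> closed S"
  using complex closed_simplex unfolding simplicial_complex_def by blast

lemma convex_triangle: "convex \<Delta>" and polyhedron_triangle: "polyhedron \<Delta>"
  and aff_dim_triangle: "aff_dim \<Delta> = 2"
  using simplex by (simp_all add: convex_simplex simplex_imp_polyhedron aff_dim_simplex)

lemma hull_subset_triangle: "A \<in> face_sets \<Gamma> \<Longrightarrow> convex hull A \<subseteq> \<Delta>"
  using Union_eq by (auto simp: face_sets_def)

lemma face_sets_subset_triangle: "A \<in> face_sets \<Gamma> \<Longrightarrow> A \<subseteq> \<Delta>"
  by (rule subset_trans[OF hull_subset hull_subset_triangle])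

lemma vertices_subset_triangle: "vertices \<Gamma> \<subseteq> \<Delta>"
  using Union_eq by (auto simp: vertices_def)

lemma triangles_face_sets: "A \<in> triangles \<Gamma> \<Longrightarrow> A \<in> face_sets \<Gamma>"
  by (simp add: triangles_def)

lemma aff_dim_face_sets: "A \<in> face_sets \<Gamma> \<Longrightarrow> aff_dim A = int (card A) - 1"
  by (auto simp: face_sets_def aff_dim_affine_independent)

lemma card_face_sets: "A \<in> face_sets \<Gamma> \<Longrightarrow> card A \<le> 3"
  using aff_dim_face_sets aff_dim_subset[OF face_sets_subset_triangle, of A]
  by (simp add: aff_dim_triangle)

lemma aff_dim_triangles: "A \<in> triangles \<Gamma> \<Longrightarrow> aff_dim A = 2"
  using aff_dim_face_sets by (simp add: triangles_def)

lemma proper_face_aff_dim: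
  assumes "F face_of \<Delta>" "F \<noteq> \<Delta>" shows "aff_dim F \<le> 1"
  using face_of_aff_dim_lt[OF convex_triangle assms] aff_dim_triangle by simp

lemma triangles_not_subset:
  assumes "A \<in> triangles \<Gamma>" "F face_of \<Delta>" "F \<noteq> \<Delta>" shows "\<not> A \<subseteq> F"
  using aff_dim_subset[of A F] aff_dim_triangles[OF assms(1)] proper_face_aff_dim[OF assms(2,3)] by auto

text \<open>The faces that miss \<open>p\<close> form a closed set, so a short enough step from
  \<open>p\<close> towards \<open>q\<close> avoids them and ends in a face that contains
  \<open>p\<close>.\<close>

lemma face_near:
  assumes p: "p \<in> \<Delta>" and q: "q \<in> \<Delta>"
  shows "\<exists>S\<in>\<Gamma>. \<exists>e. 0 < e \<and> e \<le> 1 \<and> p \<in> S \<and> p + e *\<^sub>R (q - p) \<in> S"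
proof -
  define M where "M = \<Union>{S \<in> \<Gamma>. p \<notin> S}"
  have "closed M"
    unfolding M_def using finite_complex closed_face by (intro closed_Union) auto
  moreover have "p \<notin> M" by (auto simp: M_def)
  ultimately obtain d where d: "d > 0" "ball p d \<subseteq> - M"
    using open_contains_ball[of "- M"] by (auto simp: open_Compl)
  \<comment> \<open>The bound 1 keeps the point between \<open>p\<close> and \<open>q\<close>; the
    other bound makes the step shorter than \<open>d\<close>, and adding 1 to the norm avoids a zero
    denominator.\<close>
  define e where "e = min 1 (d / (2 * (1 + norm (q - p))))"
  have n: "0 < 1 + norm (q - p)" by (simp add: add_pos_nonneg)
  have e: "0 < e" "e \<le> 1" using d(1) n by (auto simp: e_def)
  have "e * norm (q - p) \<le> d / (2 * (1 + norm (q - p))) * norm (q - p)"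
    by (intro mult_right_mono) (auto simp: e_def)
  also have "\<dots> < d"
    using d(1) n by (simp add: field_simps) (smt (verit) mult_nonneg_nonneg norm_ge_zero)
  finally have "p + e *\<^sub>R (q - p) \<in> ball p d"
    using e by (simp add: dist_norm)
  then have notM: "p + e *\<^sub>R (q - p) \<notin> M" using d by auto
  have "(1 - e) *\<^sub>R p + e *\<^sub>R q \<in> \<Delta>"
    using convex_triangle p q e by (auto simp: convex_def)
  then have "p + e *\<^sub>R (q - p) \<in> \<Delta>"
    by (simp add: algebra_simps)
  then obtain S where "S \<in> \<Gamma>" "p + e *\<^sub>R (q - p) \<in> S" using Union_eq by blast
  then show ?thesis using notM e by (auto simp: M_def)
qed

text \<open>Purity: finitely many segments through \<open>p\<close> cannot meet every point of a segment
  off \<open>p\<close>, so one of the faces at \<open>p\<close> is two-dimensional.\<close>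

lemma point_in_triangles:
  assumes p: "p \<in> \<Delta>"
  shows "\<exists>A\<in>triangles \<Gamma>. p \<in> convex hull A"
proof -
  have "\<not> \<Delta> \<subseteq> {p}"
    using aff_dim_subset[of \<Delta> "{p}"] by (auto simp: aff_dim_triangle)
  then obtain y where y: "y \<in> \<Delta>" "y \<noteq> p" by auto
  have "\<not> \<Delta> \<subseteq> affine hull {p, y}"
    using aff_dim_subset[of \<Delta> "affine hull {p, y}"] y(2) by (auto simp: aff_dim_triangle aff_dim_2)
  then obtain z where z: "z \<in> \<Delta>" "z \<notin> affine hull {p, y}" by auto
  have pyz: "y \<noteq> z" using z(2) hull_inc[of y "{p, y}"] by auto
  have pyz': "p \<notin> affine hull {y, z}"
  proof
    have "\<not> affine_dependent (insert z {p, y})"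
      using z(2) by (intro affine_independent_insert affine_independent_2)
    moreover have "insert z {p, y} - {p} = {y, z}"
      using y z hull_inc[of p "{p, y}"] by auto
    moreover assume "p \<in> affine hull {y, z}"
    ultimately show False unfolding affine_dependent_def by auto
  qed
  have "\<forall>x\<in>closed_segment y z. \<exists>S\<in>\<Gamma>. \<exists>e. 0 < e \<and> e \<le> 1 \<and> p \<in> S \<and> p + e *\<^sub>R (x - p) \<in> S"
    using face_near[OF p] closed_segment_subset[OF y(1) z(1) convex_triangle] by blast
  then obtain f where f: "\<And>x. x \<in> closed_segment y z \<Longrightarrow>
      f x \<in> \<Gamma> \<and> (\<exists>e. 0 < e \<and> e \<le> 1 \<and> p \<in> f x \<and> p + e *\<^sub>R (x - p) \<in> f x)"
    by metis
  \<comment> \<open>Infinitely many directions but finitely many faces: two directions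
    \<open>x0\<close>, \<open>x1\<close> share a face \<open>S\<close>. Its affine hull contains
    \<open>p\<close>, \<open>x0\<close> and \<open>x1\<close>, which are independent because
    \<open>p\<close> is off the line through \<open>y\<close> and \<open>z\<close>.\<close>
  have "infinite (closed_segment y z)" using pyz by simp
  moreover have "finite (f ` closed_segment y z)"
    using f finite_complex by (meson finite_subset image_subsetI)
  ultimately obtain x0 where x0: "x0 \<in> closed_segment y z" "infinite {x \<in> closed_segment y z. f x = f x0}"
    using pigeonhole_infinite by blast
  obtain x1 where x1: "x1 \<in> closed_segment y z" "f x1 = f x0" "x1 \<noteq> x0"
  proof -
    have "\<not> {x \<in> closed_segment y z. f x = f x0} \<subseteq> {x0}"
      using x0(2) finite_subset by blast
    then show ?thesis using that by blast
  qed
  define S where "S = f x0"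
  have S: "S \<in> \<Gamma>" "p \<in> S" using f[OF x0(1)] by (auto simp: S_def)
  have aff: "x \<in> affine hull S" if x: "x \<in> closed_segment y z" "f x = S" for x
  proof -
    obtain e where e: "0 < e" "p + e *\<^sub>R (x - p) \<in> S" using f[OF x(1)] x(2) by auto
    have "(1 - 1/e) *\<^sub>R p + (1/e) *\<^sub>R (p + e *\<^sub>R (x - p)) \<in> affine hull S"
      using S e by (intro mem_affine) (auto intro: hull_inc)
    also have "(1 - 1/e) *\<^sub>R p + (1/e) *\<^sub>R (p + e *\<^sub>R (x - p)) = x"
      using e by (simp add: algebra_simps)
    finally show ?thesis .
  qed
  have "{x0, x1} \<subseteq> affine hull {y, z}"
    using x0 x1 by (auto simp: segment_convex_hull intro: convex_hull_subset_affine_hull[THEN subsetD])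
  then have "p \<notin> affine hull {x0, x1}"
    using pyz' hull_minimal[of "{x0, x1}" "affine hull {y, z}" affine] by auto
  then have ind: "\<not> affine_dependent {p, x0, x1}"
    by (intro affine_independent_insert affine_independent_2)
  have "p \<notin> {x0, x1}" using \<open>p \<notin> affine hull {x0, x1}\<close> hull_inc by metis
  then have "card {p, x0, x1} = 3" using x1(3) by auto
  then have "aff_dim {p, x0, x1} = 2" using aff_dim_affine_independent[OF ind] by simp
  moreover have "{p, x0, x1} \<subseteq> affine hull S" using aff x0 x1 S by (auto simp: S_def hull_inc)
  ultimately have "2 \<le> aff_dim S" by (metis aff_dim_affine_hull aff_dim_subset)
  moreover obtain A where A: "A \<in> face_sets \<Gamma>" "S = convex hull A"
    using face_setsE[OF complex S(1)] by blast
  ultimately have "card A = 3"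
    using aff_dim_face_sets[OF A(1)] card_face_sets[OF A(1)] by (simp add: aff_dim_convex_hull)
  then show ?thesis using A S by (auto simp: triangles_def)
qed

text \<open>A triangle through a relative interior point of the face contains the whole face. The
  empty face has no such point and is treated separately.\<close>

lemma face_sets_extend:
  assumes A: "A \<in> face_sets \<Gamma>"
  shows "\<exists>B\<in>triangles \<Gamma>. A \<subseteq> B"
proof (cases "A = {}")
  case True
  have "\<Delta> \<noteq> {}" using aff_dim_triangle by auto
  then show ?thesis using True point_in_triangles by blast
next
  case False
  then obtain x where x: "x \<in> rel_interior (convex hull A)"
    using rel_interior_eq_empty[of "convex hull A"] by auto
  then have "x \<in> \<Delta>" using rel_interior_subset hull_subset_triangle[OF A] by blast
  then obtain B where "B \<in> triangles \<Gamma>" "x \<in> convex hull B" using point_in_triangles by blast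
  then show ?thesis using face_sets_subsetI[OF complex A _ x] triangles_face_sets by blast
qed

lemma triangles_near:
  assumes "p \<in> \<Delta>" "q \<in> \<Delta>"
  shows "\<exists>A\<in>triangles \<Gamma>. \<exists>e. 0 < e \<and> e \<le> 1 \<and> p \<in> convex hull A \<and> p + e *\<^sub>R (q - p) \<in> convex hull A"
proof -
  obtain S e where S: "S \<in> \<Gamma>" "0 < e" "e \<le> 1" "p \<in> S" "p + e *\<^sub>R (q - p) \<in> S"
    using face_near[OF assms] by blast
  obtain A where A: "A \<in> face_sets \<Gamma>" "S = convex hull A"
    using face_setsE[OF complex S(1)] by blast
  obtain B where "B \<in> triangles \<Gamma>" "A \<subseteq> B" using face_sets_extend[OF A(1)] by blast
  then show ?thesis using S A hull_mono[of A B convex] by blast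
qed

text \<open>Let \<open>m\<close> be a relative interior point of \<open>E\<close> and
  \<open>p\<close> a vertex of \<open>A\<close> outside \<open>E\<close>. As \<open>E\<close> is in
  no proper face, \<open>m\<close> is interior to \<open>\<Delta>\<close>, so the ray from
  \<open>p\<close> continues beyond \<open>m\<close>. A triangle that contains \<open>m\<close> and
  a point just beyond it contains \<open>E\<close>. It cannot be \<open>A\<close>, since
  \<open>m\<close> would be strictly between two points of \<open>A\<close> and the face
  \<open>E\<close> would contain \<open>p\<close>.\<close>

lemma interior_face_other_triangle:
  assumes A: "A \<in> triangles \<Gamma>" and E: "E \<subset> A" "E \<noteq> {}"
    and inner: "\<And>F. F face_of \<Delta> \<Longrightarrow> F \<noteq> \<Delta> \<Longrightarrow> \<not> E \<subseteq> F"
  shows "\<exists>B\<in>triangles \<Gamma>. E \<subseteq> B \<and> B \<noteq> A"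
proof -
  have Af: "A \<in> face_sets \<Gamma>" using A triangles_face_sets by blast
  then have Ef: "E \<in> face_sets \<Gamma>" using E face_sets_subset[OF complex] by blast
  obtain p where p: "p \<in> A" "p \<notin> E" using E by auto
  have pD: "p \<in> \<Delta>" using face_sets_subset_triangle[OF Af] p by auto
  obtain m where m: "m \<in> rel_interior (convex hull E)"
    using E(2) rel_interior_eq_empty[of "convex hull E"] by auto
  have mE: "m \<in> convex hull E" using m rel_interior_subset by blast
  have mD: "m \<in> \<Delta>" using mE hull_subset_triangle[OF Ef] by blast
  have "m \<in> rel_interior \<Delta>"
  proof (rule ccontr)
    assume "m \<notin> rel_interior \<Delta>"
    then have "m \<in> rel_frontier \<Delta>"
      using mD closure_subset by (auto simp: rel_frontier_def)
    then obtain F where F: "F facet_of \<Delta>" "m \<in> F"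
      using rel_frontier_of_polyhedron[OF polyhedron_triangle] by auto
    then have F': "F face_of \<Delta>" "F \<noteq> \<Delta>" by (auto simp: facet_of_def)
    then have "convex hull E \<subseteq> F"
      using subset_of_face_of[OF F'(1) hull_subset_triangle[OF Ef]] F(2) m by blast
    then show False using inner[OF F'] hull_subset[of E convex] by auto
  qed
  then obtain e where e: "e > 1" "(1 - e) *\<^sub>R p + e *\<^sub>R m \<in> \<Delta>"
    using convex_rel_interior_iff[OF convex_triangle] pD by blast
  define q where "q = (1 - e) *\<^sub>R p + e *\<^sub>R m"
  obtain B t where B: "B \<in> triangles \<Gamma>" "0 < t" "t \<le> 1" "m \<in> convex hull B"
    "m + t *\<^sub>R (q - m) \<in> convex hull B"
    using triangles_near[OF mD e(2)] by (auto simp: q_def)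
  have "E \<subseteq> B" using face_sets_subsetI[OF complex Ef _ m] B triangles_face_sets by blast
  moreover have "B \<noteq> A"
  proof
    assume "B = A"
    define x where "x = m + t *\<^sub>R (q - m)"
    \<comment> \<open>\<open>x\<close> is the point beyond \<open>m\<close>, at \<open>s\<close>
      times the distance from \<open>p\<close> to \<open>m\<close>; hence \<open>m\<close> divides
      the segment from \<open>p\<close> to \<open>x\<close> with weight \<open>1 / (1 + s)\<close>
      at \<open>x\<close>.\<close>
    define s where "s = t * (e - 1)"
    have s: "s > 0" using B e by (simp add: s_def)
    have x_eq: "x = m + s *\<^sub>R (m - p)"
      by (simp add: x_def q_def s_def algebra_simps)
    have "p \<noteq> m"
      using vertex_in_hull[OF complex Ef] p mE face_sets_vertices[OF complex Af] by blast
    have "p \<noteq> x"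
    proof
      assume "p = x"
      then have "(1 + s) *\<^sub>R (m - p) = 0" by (simp add: x_eq algebra_simps)
      then show False using s \<open>p \<noteq> m\<close> by simp
    qed
    moreover have "m = (1 - 1 / (1 + s)) *\<^sub>R p + (1 / (1 + s)) *\<^sub>R x"
    proof -
      have "1 + s \<noteq> 0" using s by simp
      have "(1 + s) *\<^sub>R m = s *\<^sub>R p + x" by (simp add: x_eq algebra_simps)
      then have "(1 / (1 + s)) *\<^sub>R ((1 + s) *\<^sub>R m) = (1 / (1 + s)) *\<^sub>R (s *\<^sub>R p + x)" by simp
      then have "m = (s / (1 + s)) *\<^sub>R p + (1 / (1 + s)) *\<^sub>R x"
        using \<open>1 + s \<noteq> 0\<close> by (simp add: scaleR_add_right)
      also have "s / (1 + s) = 1 - 1 / (1 + s)" using \<open>1 + s \<noteq> 0\<close> by (simp add: field_simps)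
      finally show ?thesis .
    qed
    ultimately have "m \<in> open_segment p x"
      using s unfolding in_segment by (intro conjI exI[of _ "1 / (1 + s)"]) auto
    moreover have "convex hull E face_of convex hull A"
      using E Af by (auto simp: face_of_convex_hull_affine_independent face_sets_def)
    moreover have "p \<in> convex hull A" "x \<in> convex hull A"
      using B \<open>B = A\<close> p hull_inc by (auto simp: x_def)
    ultimately have "p \<in> convex hull E" using mE unfolding face_of_def by blast
    then show False
      using vertex_in_hull[OF complex Ef] p face_sets_vertices[OF complex Af] by blast
  qed
  ultimately show ?thesis using B by blast
qed

text \<open>Otherwise both triangles lie on the same side of the line through \<open>E\<close> and overlap near the
  midpoint of \<open>E\<close>.\<close>

lemma boundary_edge_unique_triangle:
  assumes A: "A \<in> triangles \<Gamma>" and B: "B \<in> triangles \<Gamma>"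
    and E: "E \<subseteq> A" "E \<subseteq> B" "card E = 2"
    and F: "F face_of \<Delta>" "F \<noteq> \<Delta>" "E \<subseteq> F"
  shows "A = B"
proof (rule ccontr)
  assume "A \<noteq> B"
  have fs: "A \<in> face_sets \<Gamma>" "B \<in> face_sets \<Gamma>" using A B triangles_face_sets by auto
  have card: "card A = 3" "card B = 3" using A B by (auto simp: triangles_def)
  have fin: "finite A" "finite B" using card by (metis card.infinite zero_neq_numeral)+
  have "card (A - E) = 1" "card (B - E) = 1"
    using card E fin by (auto simp: card_Diff_subset finite_subset)
  then obtain p q where pq: "A - E = {p}" "B - E = {q}" by (auto simp: card_1_singleton_iff)
  obtain u w where uw: "E = {u, w}" "u \<noteq> w" using E(3) by (auto simp: card_2_iff)
  have Aeq: "A = {u, w, p}" and Beq: "B = {u, w, q}" using pq E uw by auto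
  have dist: "p \<noteq> u" "p \<noteq> w" "q \<noteq> u" "q \<noteq> w" using pq uw by auto
  have "p \<noteq> q" using \<open>A \<noteq> B\<close> Aeq Beq by auto
  have Int: "convex hull A \<inter> convex hull B = convex hull {u, w}"
    using face_sets_Int[OF complex fs] dist \<open>p \<noteq> q\<close> by (simp add: Aeq Beq insert_commute)
  have q_notin: "q \<notin> affine hull {u, w}"
  proof
    assume "q \<in> affine hull {u, w}"
    moreover have "B - {q} = {u, w}" using Beq dist by auto
    ultimately have "affine_dependent B" unfolding affine_dependent_def using Beq by auto
    then show False using fs by (simp add: face_sets_def)
  qed
  have "affine hull A = affine hull \<Delta>"
    using face_sets_subset_triangle[OF fs(1)] aff_dim_triangles[OF A] aff_dim_triangle Aeq
    by (intro affine_dim_equal) (auto intro: hull_mono[THEN subsetD])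
  then have "q \<in> affine hull A"
    using face_sets_subset_triangle[OF fs(2)] Beq hull_inc[of q \<Delta> affine] by auto
  then obtain \<alpha> \<beta> \<gamma> where q: "\<alpha> + \<beta> + \<gamma> = 1" "q = \<alpha> *\<^sub>R u + \<beta> *\<^sub>R w + \<gamma> *\<^sub>R p"
    by (auto simp: Aeq affine_hull_3)
  \<comment> \<open>The sign of the barycentric coordinate of \<open>q\<close> at \<open>p\<close>
    tells on which side of the line through \<open>E\<close> the point \<open>q\<close>
    lies.\<close>
  consider "\<gamma> > 0" | "\<gamma> = 0" | "\<gamma> < 0" by linarith
  then show False
  proof cases
    case 1
    \<comment> \<open>The point \<open>m\<close> below is reached from the midpoint of
      \<open>E\<close> by moving towards \<open>q\<close>. This \<open>e\<close> is small enough for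
      the coordinates of \<open>m\<close> at \<open>u\<close> and \<open>w\<close> to stay
      nonnegative, so \<open>m\<close> is in both triangles and hence on \<open>E\<close>; solving
      for \<open>q\<close> puts \<open>q\<close> on the line through \<open>E\<close>.\<close>
    define e where "e = 1 / (2 + 2 * \<bar>\<alpha>\<bar> + 2 * \<bar>\<beta>\<bar>)"
    have e: "0 < e" "e < 1" by (auto simp: e_def field_simps) 
    have "e * (1 + 2 * \<bar>\<alpha>\<bar>) \<le> 1" "e * (1 + 2 * \<bar>\<beta>\<bar>) \<le> 1"
      by (auto simp: e_def field_simps)
    moreover have "- (e * \<bar>\<alpha>\<bar>) \<le> e * \<alpha>" "- (e * \<bar>\<beta>\<bar>) \<le> e * \<beta>"
      using mult_left_mono[of "- \<bar>\<alpha>\<bar>" \<alpha> e] mult_left_mono[of "- \<bar>\<beta>\<bar>" \<beta> e] e by auto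
    ultimately have pos: "0 \<le> (1 - e) / 2 + e * \<alpha>" "0 \<le> (1 - e) / 2 + e * \<beta>"
      by (simp_all add: field_simps)
    define m where "m = ((1 - e) / 2) *\<^sub>R u + ((1 - e) / 2) *\<^sub>R w + e *\<^sub>R q"
    have "m \<in> convex hull B"
      unfolding Beq convex_hull_3 m_def using e
      by (intro CollectI exI[of _ "(1 - e) / 2"] exI[of _ e]) auto
    moreover have "m = ((1 - e) / 2 + e * \<alpha>) *\<^sub>R u + ((1 - e) / 2 + e * \<beta>) *\<^sub>R w + (e * \<gamma>) *\<^sub>R p"
      by (simp add: m_def q(2) algebra_simps)
    moreover have "(1 - e) / 2 + e * \<alpha> + ((1 - e) / 2 + e * \<beta>) + e * \<gamma> = 1"
    proof -
      have "e * \<alpha> + e * \<beta> + e * \<gamma> = e" using q(1) by (simp flip: distrib_left)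
      then show ?thesis by (simp add: field_simps)
    qed
    ultimately have "m \<in> convex hull A"
      using pos 1 e unfolding Aeq convex_hull_3
      by (intro CollectI exI[of _ "(1 - e) / 2 + e * \<alpha>"] exI[of _ "(1 - e) / 2 + e * \<beta>"] exI[of _ "e * \<gamma>"]) auto
    then have "m \<in> affine hull {u, w}"
      using Int \<open>m \<in> convex hull B\<close> convex_hull_subset_affine_hull[of "{u, w}"] by auto
    then obtain s t where st: "s + t = 1" "m = s *\<^sub>R u + t *\<^sub>R w" by (auto simp: affine_hull_2)
    have "e *\<^sub>R q = (s - (1 - e) / 2) *\<^sub>R u + (t - (1 - e) / 2) *\<^sub>R w"
      using st(2) by (simp add: m_def algebra_simps)
    then have "(1 / e) *\<^sub>R (e *\<^sub>R q) = ((s - (1 - e) / 2) / e) *\<^sub>R u + ((t - (1 - e) / 2) / e) *\<^sub>R w"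
      by (simp add: scaleR_add_right)
    then have "q = ((s - (1 - e) / 2) / e) *\<^sub>R u + ((t - (1 - e) / 2) / e) *\<^sub>R w" using e by simp
    moreover have "(s - (1 - e) / 2) / e + (t - (1 - e) / 2) / e = 1"
    proof -
      have "(s - (1 - e) / 2) / e + (t - (1 - e) / 2) / e = (s + t - (1 - e)) / e"
        using e by (simp add: field_simps)
      then show ?thesis using st(1) e by simp
    qed
    ultimately have "q \<in> affine hull {u, w}" unfolding affine_hull_2 by blast
    then show False using q_notin by blast
  next
    case 2
    then have "q \<in> affine hull {u, w}" using q unfolding affine_hull_2 by auto
    then show False using q_notin by blast
  next
    case 3
    \<comment> \<open>The weights cancel the coordinate at \<open>p\<close>, so \<open>r\<close> is
      where the segment from \<open>q\<close> to \<open>p\<close> crosses the line through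
      \<open>E\<close>. The face \<open>F\<close> contains this inner point of the segment and
      therefore \<open>p\<close>, hence all of \<open>A\<close>.\<close>
    define r where "r = (1 - (- \<gamma> / (1 - \<gamma>))) *\<^sub>R q + (- \<gamma> / (1 - \<gamma>)) *\<^sub>R p"
    have "1 - (- \<gamma> / (1 - \<gamma>)) = 1 / (1 - \<gamma>)" using 3 by (simp add: field_simps)
    then have "r = (\<alpha> / (1 - \<gamma>)) *\<^sub>R u + (\<beta> / (1 - \<gamma>)) *\<^sub>R w"
      by (simp add: r_def q(2) algebra_simps)
    moreover have "\<alpha> / (1 - \<gamma>) + \<beta> / (1 - \<gamma>) = 1"
    proof -
      have "\<alpha> + \<beta> = 1 - \<gamma>" using q(1) by simp
      then show ?thesis using 3 by (simp flip: add_divide_distrib)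
    qed
    ultimately have "r \<in> affine hull {u, w}" unfolding affine_hull_2 by blast
    then have "r \<in> affine hull F" using hull_mono[of "{u, w}" F affine] F(3) uw by auto
    have pqD: "p \<in> \<Delta>" "q \<in> \<Delta>" using Aeq Beq fs face_sets_subset_triangle by blast+
    have r: "r \<in> open_segment q p"
    proof -
      have "0 < - \<gamma> / (1 - \<gamma>)" "- \<gamma> / (1 - \<gamma>) < 1" using 3 by (auto simp: field_simps)
      then show ?thesis
        unfolding in_segment r_def using \<open>p \<noteq> q\<close> by blast
    qed
    then have "r \<in> \<Delta>" using closed_segment_subset[OF pqD(2,1) convex_triangle] open_closed_segment by blast
    then have "r \<in> F"
      using face_of_imp_eq_affine_Int[OF convex_triangle F(1)] \<open>r \<in> affine hull F\<close> by blast
    then have "p \<in> F" using F(1) pqD r unfolding face_of_def by blast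
    then have "A \<subseteq> F" using F(3) uw Aeq by auto
    then show False using triangles_not_subset[OF A F(1,2)] by blast
  qed
qed

text \<open>Naming both ends allows one to speak of directions along the side;
  \<open>b \<noteq> c\<close> excludes the corners, whose degenerate segments are faces as
  well.\<close>

definition side :: "'a \<Rightarrow> 'a \<Rightarrow> bool" where
  "side b c \<longleftrightarrow> b \<noteq> c \<and> closed_segment b c face_of \<Delta>"

lemma side_commute: "side b c \<longleftrightarrow> side c b"
  by (auto simp: side_def closed_segment_commute)

lemma side_proper: "closed_segment b c \<noteq> \<Delta>"
proof
  assume "closed_segment b c = \<Delta>"
  then have "aff_dim (closed_segment b c) = 2" by (simp add: aff_dim_triangle)
  then show False by (simp add: segment_convex_hull aff_dim_convex_hull aff_dim_2 split: if_splits)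
qed

text \<open>Otherwise the nearer of the two points would be a vertex inside the edge from
  \<open>v\<close> to the farther one. Thus at most one edge leaves \<open>v\<close> in the
  direction of \<open>b\<close>.\<close>

lemma ray_unique:
  assumes fs: "{v, p} \<in> face_sets \<Gamma>" "{v, q} \<in> face_sets \<Gamma>"
    and p: "p \<in> closed_segment v b" "p \<noteq> v" and q: "q \<in> closed_segment v b" "q \<noteq> v"
  shows "p = q"
proof -
  have *: "p = q" if fs: "{v, p} \<in> face_sets \<Gamma>" "{v, q} \<in> face_sets \<Gamma>" and "p \<noteq> v"
    and p: "p = v + s *\<^sub>R (b - v)" and q: "q = v + t *\<^sub>R (b - v)" and st: "0 < s" "s \<le> t" for p q s t
  proof -
    have "p = (1 - s / t) *\<^sub>R v + (s / t) *\<^sub>R q" using st by (simp add: p q algebra_simps)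
    then have "p \<in> closed_segment v q" using st unfolding in_segment by (intro exI[of _ "s / t"]) auto
    then have "p \<in> convex hull {v, q}" by (simp add: segment_convex_hull)
    moreover have "p \<in> vertices \<Gamma>" using face_sets_vertices[OF complex fs(1)] by auto
    ultimately show ?thesis using vertex_in_hull[OF complex fs(2)] \<open>p \<noteq> v\<close> by auto
  qed
  obtain s where s: "0 \<le> s" "p = v + s *\<^sub>R (b - v)" using p(1) by (auto simp: in_segment algebra_simps)
  obtain t where t: "0 \<le> t" "q = v + t *\<^sub>R (b - v)" using q(1) by (auto simp: in_segment algebra_simps)
  have "0 < s" "0 < t" using s t p q by (auto simp: less_le)
  then show ?thesis using *[OF fs p(2) s(2) t(2)] *[OF fs(2,1) q(2) t(2) s(2)] by force
qed

text \<open>A triangle containing \<open>v\<close> and a nearby point in the direction of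
  \<open>b\<close> meets the side in one of its own faces. That face contains \<open>v\<close> and a
  second point but is not the whole triangle, so it is an edge. The case \<open>v = c\<close> is
  included, which serves the corners.\<close>

lemma triangle_in_direction:
  assumes v: "v \<in> vertices \<Gamma>" "v \<in> closed_segment b c" "v \<noteq> b" and side: "side b c"
  shows "\<exists>p0 p1. {v, p0, p1} \<in> triangles \<Gamma> \<and> p0 \<noteq> v \<and> p1 \<noteq> v \<and> p0 \<noteq> p1 \<and>
    p0 \<in> closed_segment v b \<and> p1 \<notin> closed_segment b c"
proof -
  let ?F = "closed_segment b c"
  have F: "?F face_of \<Delta>" "b \<noteq> c" using side by (auto simp: side_def)
  have bD: "b \<in> \<Delta>" "v \<in> \<Delta>" using face_of_imp_subset[OF F(1)] v(2) by auto
  obtain A e where A: "A \<in> triangles \<Gamma>" and e: "0 < e" "e \<le> 1"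
    and vA: "v \<in> convex hull A" and xA: "v + e *\<^sub>R (b - v) \<in> convex hull A"
    using triangles_near[OF bD(2,1)] by blast
  define x where "x = v + e *\<^sub>R (b - v)"
  have Af: "A \<in> face_sets \<Gamma>" using A triangles_face_sets by blast
  have vA': "v \<in> A" using vertex_in_hull[OF complex Af v(1) vA] .
  have xv: "x \<noteq> v" using e v(3) by (simp add: x_def)
  have xF: "x \<in> ?F"
  proof -
    have "x \<in> closed_segment v b" unfolding in_segment x_def using e
      by (intro exI[of _ e]) (auto simp: algebra_simps)
    then show ?thesis using closed_segment_subset[of v ?F b] v(2) by auto
  qed
  have "?F \<inter> convex hull A face_of \<Delta> \<inter> convex hull A"
    by (rule face_of_slice[OF F(1)]) simp
  then have "?F \<inter> convex hull A face_of convex hull A"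
    using hull_subset_triangle[OF Af] by (simp add: Int_absorb1)
  then obtain C where C: "C \<subseteq> A" "?F \<inter> convex hull A = convex hull C"
    using face_of_convex_hull_affine_independent[of A] Af by (auto simp: face_sets_def)
  have CF: "C \<subseteq> ?F" using hull_subset[of C convex] C(2) by auto
  have Cf: "C \<in> face_sets \<Gamma>" using face_sets_subset[OF complex Af C(1)] .
  have xC: "x \<in> convex hull C" using C(2) xF xA by (auto simp: x_def)
  have vC: "v \<in> C" using vertex_in_hull[OF complex Cf v(1)] C(2) v(2) vA by auto
  have cardA: "card A = 3" using A by (simp add: triangles_def)
  then have finA: "finite A" by (metis card.infinite zero_neq_numeral)
  have "C \<noteq> A" using triangles_not_subset[OF A F(1) side_proper] CF by auto
  then have "card C < 3" using psubset_card_mono[OF finA, of C] C(1) cardA by auto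
  moreover have "C \<noteq> {v}" using xC xv by auto
  moreover have "card C \<noteq> 0" using vC finite_subset[OF C(1) finA] by auto
  moreover have "card C \<noteq> 1" using \<open>C \<noteq> {v}\<close> vC by (auto simp: card_1_singleton_iff)
  ultimately have "card C = 2" by linarith
  then obtain p0 where p0: "C = {v, p0}" "p0 \<noteq> v" using vC by (auto simp: card_2_iff)
  have "card (A - C) = 1" using cardA \<open>card C = 2\<close> C(1) finA by (simp add: card_Diff_subset finite_subset)
  then obtain p1 where p1: "A - C = {p1}" by (auto simp: card_1_singleton_iff)
  have Aeq: "A = {v, p0, p1}" using p1 p0 C(1) by auto
  have "p1 \<notin> ?F" using triangles_not_subset[OF A F(1) side_proper] CF p0 Aeq by auto
  \<comment> \<open>With parameters measured from \<open>b\<close>, the point \<open>x\<close> is at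
    \<open>t - e * t\<close> and also on the way from \<open>v\<close> at \<open>t\<close> to
    \<open>p0\<close> at \<open>t'\<close>. This excludes \<open>t' > t\<close>, so
    \<open>p0\<close> is on the same side of \<open>v\<close> as \<open>b\<close>.\<close>
  moreover have "p0 \<in> closed_segment v b"
  proof -
    obtain t where t: "0 \<le> t" "t \<le> 1" "v = b + t *\<^sub>R (c - b)"
      using v(2) by (auto simp: in_segment algebra_simps)
    obtain t' where t': "0 \<le> t'" "t' \<le> 1" "p0 = b + t' *\<^sub>R (c - b)"
      using CF p0 by (auto simp: in_segment algebra_simps)
    obtain s where s: "0 \<le> s" "s \<le> 1" "x = v + s *\<^sub>R (p0 - v)"
      using xC p0 by (auto simp: segment_convex_hull[symmetric] in_segment algebra_simps)
    have t0: "t > 0" using t v(3) by (auto simp: less_le)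
    have "(s * (t' - t) + e * t) *\<^sub>R (c - b) = 0"
      using s(3) unfolding x_def t(3) t'(3) by (simp add: algebra_simps)
    then have st: "s * (t' - t) + e * t = 0" using F(2) by simp
    have "t' \<le> t"
    proof (rule ccontr)
      assume "\<not> t' \<le> t"
      then have "0 \<le> s * (t' - t)" using s(1) by simp
      moreover have "0 < e * t" using e t0 by simp
      ultimately show False using st by linarith
    qed
    have "p0 = v + (1 - t' / t) *\<^sub>R (b - v)"
      using t0 unfolding t(3) t'(3) by (simp add: algebra_simps)
    then have "p0 = (1 - (1 - t' / t)) *\<^sub>R v + (1 - t' / t) *\<^sub>R b" by (simp add: algebra_simps)
    moreover have "0 \<le> 1 - t' / t" "1 - t' / t \<le> 1" using t0 t' \<open>t' \<le> t\<close> by (auto simp: field_simps)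
    ultimately show ?thesis unfolding in_segment by blast
  qed
  moreover have "p1 \<noteq> v" "p0 \<noteq> p1" using p1 p0 by auto
  ultimately show ?thesis using A p0(2) unfolding Aeq by blast
qed

section \<open>Triangles at a boundary vertex\<close>

lemma triangles_distinct:
  "{u, v, w} \<in> triangles \<Gamma> \<Longrightarrow> u \<noteq> v \<and> u \<noteq> w \<and> v \<noteq> w"
  by (auto simp: triangles_def card_insert_if split: if_splits)

lemma triangles_vertices: "A \<in> triangles \<Gamma> \<Longrightarrow> A \<subseteq> vertices \<Gamma>"
  using face_sets_vertices[OF complex] triangles_face_sets by blast

lemma triangles_subset_face_sets: "A \<in> triangles \<Gamma> \<Longrightarrow> E \<subseteq> A \<Longrightarrow> E \<in> face_sets \<Gamma>"
  using face_sets_subset[OF complex] triangles_face_sets by blast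

lemma finite_triangles_at: "finite (triangles_at \<Gamma> v)"
  using finite_triangles[OF complex] by (simp add: triangles_at_def)

text \<open>A face through the inner point \<open>v\<close> of the side contains \<open>b\<close>
  and \<open>c\<close>, hence the side; if it also contains \<open>p\<close>, its dimension exceeds
  one. So the edge from \<open>v\<close> to \<open>p\<close> is in no proper face.\<close>

lemma inner_edge_other_triangle:
  assumes side: "side b c" and v: "v \<in> open_segment b c"
    and A: "A \<in> triangles \<Gamma>" "v \<in> A" "p \<in> A" and p: "p \<notin> closed_segment b c"
  shows "\<exists>B\<in>triangles \<Gamma>. v \<in> B \<and> p \<in> B \<and> B \<noteq> A"
proof -
  let ?F = "closed_segment b c"
  have "\<not> {v, p} \<subseteq> F" if F: "F face_of \<Delta>" "F \<noteq> \<Delta>" for F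
  proof
    assume vp: "{v, p} \<subseteq> F"
    have FF: "?F face_of \<Delta>" "b \<noteq> c" using side by (auto simp: side_def)
    then have "b \<in> \<Delta>" "c \<in> \<Delta>" using face_of_imp_subset by blast+
    then have "b \<in> F" "c \<in> F" using F(1) v vp unfolding face_of_def by blast+
    then have "?F \<subseteq> F" using closed_segment_subset face_of_imp_convex[OF F(1)] by blast
    then have "?F face_of F" using face_of_subset[OF FF(1)] face_of_imp_subset[OF F(1)] by blast
    moreover have "?F \<noteq> F" using vp p by auto
    ultimately have "aff_dim ?F < aff_dim F"
      using face_of_aff_dim_lt face_of_imp_convex[OF F(1)] by blast
    moreover have "aff_dim ?F = 1"
      using FF(2) by (simp add: segment_convex_hull aff_dim_convex_hull aff_dim_2)
    ultimately show False using proper_face_aff_dim[OF F] by simp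
  qed
  moreover have "{v, p} \<noteq> A"
    using A(1) by (auto simp: triangles_def card_insert_if split: if_splits)
  ultimately show ?thesis
    using interior_face_other_triangle[OF A(1), of "{v, p}"] A by auto
qed

lemma two_directions:
  assumes side: "side b c" and v: "v \<in> open_segment b c" "v \<in> vertices \<Gamma>"
  obtains p0 p1 q0 q1 where
    "{v, p0, p1} \<in> triangles \<Gamma>" "p0 \<noteq> v" "p0 \<in> closed_segment v b" "p1 \<notin> closed_segment b c"
    "{v, q0, q1} \<in> triangles \<Gamma>" "q0 \<noteq> v" "q0 \<in> closed_segment v c" "q1 \<notin> closed_segment b c"
    "{v, p0, p1} \<noteq> {v, q0, q1}"
proof -
  have v': "v \<in> closed_segment b c" "v \<noteq> b" "v \<noteq> c" "v \<in> closed_segment c b"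
    using v(1) by (auto simp: open_segment_def closed_segment_commute)
  obtain p0 p1 where p: "{v, p0, p1} \<in> triangles \<Gamma>" "p0 \<noteq> v" "p0 \<in> closed_segment v b" "p1 \<notin> closed_segment b c"
    using triangle_in_direction[OF v(2) v'(1,2) side] by blast
  obtain q0 q1 where q: "{v, q0, q1} \<in> triangles \<Gamma>" "q0 \<noteq> v" "q0 \<in> closed_segment v c" "q1 \<notin> closed_segment b c"
    using triangle_in_direction[OF v(2) v'(4,3)] side side_commute by (metis closed_segment_commute)
  have "p0 \<in> closed_segment b c"
    using p(3) v'(1) closed_segment_subset[of v "closed_segment b c" b] by auto
  then have "p0 \<notin> {v, q0, q1}" using p q closed_segment_meet[OF v'(1)] by auto
  then have "{v, p0, p1} \<noteq> {v, q0, q1}" by blast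
  then show ?thesis using that p q by blast
qed

lemma triangles_at_2:
  assumes side: "side b c" and v: "v \<in> open_segment b c" "v \<in> vertices \<Gamma>"
    and card: "card (triangles_at \<Gamma> v) \<le> 2"
  obtains w p0 q0 where "triangles_at \<Gamma> v = {{v, w, p0}, {v, w, q0}}"
    "p0 \<noteq> v" "p0 \<in> closed_segment v b" "q0 \<noteq> v" "q0 \<in> closed_segment v c" "w \<notin> closed_segment b c"
proof -
  obtain p0 p1 q0 q1 where
    p: "{v, p0, p1} \<in> triangles \<Gamma>" "p0 \<noteq> v" "p0 \<in> closed_segment v b" "p1 \<notin> closed_segment b c" and
    q: "{v, q0, q1} \<in> triangles \<Gamma>" "q0 \<noteq> v" "q0 \<in> closed_segment v c" "q1 \<notin> closed_segment b c"
    and ne: "{v, p0, p1} \<noteq> {v, q0, q1}"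
    using two_directions[OF side v] by metis
  have sub: "{{v, p0, p1}, {v, q0, q1}} \<subseteq> triangles_at \<Gamma> v"
    using p q by (auto simp: triangles_at_def)
  have "card {{v, p0, p1}, {v, q0, q1}} = 2" using ne by simp
  then have eq: "triangles_at \<Gamma> v = {{v, p0, p1}, {v, q0, q1}}"
    using card_seteq[OF finite_triangles_at sub] card by simp
  \<comment> \<open>The inner edge from \<open>v\<close> to \<open>p1\<close> needs a second
    triangle, and only one candidate remains. As \<open>q0\<close> is on the side and
    \<open>p1\<close> is not, the apexes \<open>p1\<close> and \<open>q1\<close> coincide.\<close>
  obtain X where X: "X \<in> triangles \<Gamma>" "v \<in> X" "p1 \<in> X" "X \<noteq> {v, p0, p1}"
    using inner_edge_other_triangle[OF side v(1) p(1) _ _ p(4)] by auto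
  then have "X \<in> triangles_at \<Gamma> v" by (simp add: triangles_at_def)
  then have "X = {v, q0, q1}" using eq X by auto
  then have "p1 = v \<or> p1 = q0 \<or> p1 = q1" using X by auto
  moreover have "v \<in> closed_segment b c" using v(1) by (auto simp: open_segment_def)
  moreover then have "q0 \<in> closed_segment b c"
    using q(3) closed_segment_subset[of v "closed_segment b c" c] by auto
  ultimately have "p1 = q1" using p(4) by auto
  then show ?thesis using that[of p1 p0 q0] p q eq by (auto simp: insert_commute)
qed

text \<open>The third triangle has no edge at \<open>v\<close> along the side, because the triangles
  at those two edges are already known and unique. Both of its edges at \<open>v\<close> are thus
  inner and shared with the first two triangles, which closes the fan.\<close>

lemma triangles_at_3:
  assumes side: "side b c" and v: "v \<in> open_segment b c" "v \<in> vertices \<Gamma>"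
    and card: "card (triangles_at \<Gamma> v) = 3"
  obtains p0 p1 q1 q0 where "triangles_at \<Gamma> v = {{v, p0, p1}, {v, p1, q1}, {v, q1, q0}}"
    "p0 \<noteq> v" "p0 \<in> closed_segment v b" "q0 \<noteq> v" "q0 \<in> closed_segment v c"
    "p1 \<notin> closed_segment b c" "q1 \<notin> closed_segment b c" "p1 \<noteq> q1"
proof -
  let ?F = "closed_segment b c"
  obtain p0 p1 q0 q1 where
    p: "{v, p0, p1} \<in> triangles \<Gamma>" "p0 \<noteq> v" "p0 \<in> closed_segment v b" "p1 \<notin> ?F" and
    q: "{v, q0, q1} \<in> triangles \<Gamma>" "q0 \<noteq> v" "q0 \<in> closed_segment v c" "q1 \<notin> ?F"
    and ne: "{v, p0, p1} \<noteq> {v, q0, q1}"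
    using two_directions[OF side v] by metis
  have F: "?F face_of \<Delta>" using side by (simp add: side_def)
  have vF: "v \<in> ?F" using v(1) by (auto simp: open_segment_def)
  have pF: "p0 \<in> ?F" using p(3) vF closed_segment_subset[of v ?F b] by auto
  have qF: "q0 \<in> ?F" using q(3) vF closed_segment_subset[of v ?F c] by auto
  have sub: "{{v, p0, p1}, {v, q0, q1}} \<subseteq> triangles_at \<Gamma> v"
    using p q by (auto simp: triangles_at_def)
  have "card {{v, p0, p1}, {v, q0, q1}} = 2" using ne by simp
  then have "card (triangles_at \<Gamma> v - {{v, p0, p1}, {v, q0, q1}}) = 1"
    using card sub by (subst card_Diff_subset) auto
  then obtain C where C: "triangles_at \<Gamma> v - {{v, p0, p1}, {v, q0, q1}} = {C}"
    by (auto simp: card_1_singleton_iff)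
  then have eq: "triangles_at \<Gamma> v = {{v, p0, p1}, {v, q0, q1}, C}"
    using Diff_partition[OF sub, unfolded C, symmetric] by (simp only: Un_insert_left Un_empty_left)
  have CT: "C \<in> triangles \<Gamma>" "v \<in> C" "C \<noteq> {v, p0, p1}" "C \<noteq> {v, q0, q1}"
    using C by (auto simp: triangles_at_def)
  have notF: "x \<notin> ?F" if x: "x \<in> C" "x \<noteq> v" for x
  proof
    assume "x \<in> ?F"
    have xf: "{v, x} \<in> face_sets \<Gamma>" using triangles_subset_face_sets[OF CT(1)] CT(2) x by auto
    from closed_segment_cases[OF vF \<open>x \<in> ?F\<close>] show False
    proof
      assume xb: "x \<in> closed_segment v b"
      have "x = p0" using ray_unique[OF xf triangles_subset_face_sets[OF p(1)] xb x(2) p(3,2)] by auto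
      then have "C = {v, p0, p1}"
        using boundary_edge_unique_triangle[OF CT(1) p(1), of "{v, p0}"] CT(2) x F side_proper pF vF by auto
      then show False using CT by simp
    next
      assume xb: "x \<in> closed_segment v c"
      have "x = q0" using ray_unique[OF xf triangles_subset_face_sets[OF q(1)] xb x(2) q(3,2)] by auto
      then have "C = {v, q0, q1}"
        using boundary_edge_unique_triangle[OF CT(1) q(1), of "{v, q0}"] CT(2) x F side_proper qF vF by auto
      then show False using CT by simp
    qed
  qed
  \<comment> \<open>The second triangle at the inner edge from \<open>v\<close> to \<open>x\<close>
    is one of the two outer ones, whose only vertices off the side are \<open>p1\<close> and
    \<open>q1\<close>.\<close>
  have mem: "x = p1 \<or> x = q1" if x: "x \<in> C" "x \<noteq> v" for x
  proof -
    obtain X where X: "X \<in> triangles \<Gamma>" "v \<in> X" "x \<in> X" "X \<noteq> C"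
      using inner_edge_other_triangle[OF side v(1) CT(1,2) x(1) notF[OF x]] by blast
    then have "X \<in> triangles_at \<Gamma> v" by (simp add: triangles_at_def)
    then have "X = {v, p0, p1} \<or> X = {v, q0, q1}" using eq X(4) by auto
    then show ?thesis using X(3) x notF[OF x] pF qF by auto
  qed
  have "card (C - {v}) = 2" using CT by (simp add: triangles_def)
  then obtain c1 c2 where c: "C - {v} = {c1, c2}" "c1 \<noteq> c2" by (auto simp: card_2_iff)
  then have c12: "c1 \<in> C" "c2 \<in> C" "c1 \<noteq> v" "c2 \<noteq> v" by auto
  have "{c1, c2} = {p1, q1}" "p1 \<noteq> q1" using mem[OF c12(1,3)] mem[OF c12(2,4)] c(2) by auto
  then have "C = {v, p1, q1}" using c(1) CT(2) by blast
  then have "triangles_at \<Gamma> v = {{v, p0, p1}, {v, p1, q1}, {v, q1, q0}}"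
    unfolding eq by (auto simp: insert_commute)
  then show ?thesis using that p q \<open>p1 \<noteq> q1\<close> by blast
qed

section \<open>Incidences of vertices and triangles\<close>

lemma card_triangles_at_ge_1:
  assumes "v \<in> vertices \<Gamma>" shows "1 \<le> card (triangles_at \<Gamma> v)"
proof -
  obtain A where "A \<in> triangles \<Gamma>" "{v} \<subseteq> A"
    using face_sets_extend face_sets_singleton[OF complex] assms by blast
  then have "triangles_at \<Gamma> v \<noteq> {}" by (auto simp: triangles_at_def)
  then show ?thesis using finite_triangles_at by (simp add: Suc_leI card_gt_0_iff)
qed

lemma sum_card_triangles_at: "(\<Sum>v\<in>vertices \<Gamma>. card (triangles_at \<Gamma> v)) = 3 * card (triangles \<Gamma>)"
proof -
  have "(\<Sum>v\<in>vertices \<Gamma>. card (triangles_at \<Gamma> v)) = (\<Sum>A\<in>triangles \<Gamma>. card {v \<in> vertices \<Gamma>. v \<in> A})"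
    unfolding triangles_at_def
    using sum_multicount_gen[of "vertices \<Gamma>" "triangles \<Gamma>" "\<lambda>v A. v \<in> A" "\<lambda>A. card {v \<in> vertices \<Gamma>. v \<in> A}"]
      finite_vertices[OF complex] finite_triangles[OF complex] by simp
  also have "\<dots> = (\<Sum>A\<in>triangles \<Gamma>. 3)"
  proof (rule sum.cong)
    fix A assume A: "A \<in> triangles \<Gamma>"
    then have "{v \<in> vertices \<Gamma>. v \<in> A} = A" using triangles_vertices by blast
    then show "card {v \<in> vertices \<Gamma>. v \<in> A} = 3" using A by (simp add: triangles_def)
  qed simp
  finally show ?thesis by simp
qed

text \<open>By purity the triangles determine the complex; this reduces the final identification to
  a list of triangles.\<close>

lemma faces_eq: "\<Gamma> = {F. \<exists>A\<in>triangles \<Gamma>. F face_of convex hull A}"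
proof (intro set_eqI iffI)
  fix S assume "S \<in> \<Gamma>"
  then obtain B where B: "B \<in> face_sets \<Gamma>" "S = convex hull B" using face_setsE[OF complex] by blast
  then obtain A where A: "A \<in> triangles \<Gamma>" "B \<subseteq> A" using face_sets_extend by blast
  then have "\<not> affine_dependent A" by (simp add: triangles_def face_sets_def)
  then have "S face_of convex hull A"
    using A B by (auto simp: face_of_convex_hull_affine_independent)
  then show "S \<in> {F. \<exists>A\<in>triangles \<Gamma>. F face_of convex hull A}" using A by blast
next
  fix S assume "S \<in> {F. \<exists>A\<in>triangles \<Gamma>. F face_of convex hull A}"
  then show "S \<in> \<Gamma>" using complex unfolding simplicial_complex_def triangles_def face_sets_def by blast
qed

end

section \<open>The trivial subdivision and the triforce\<close>

context triangulated_triangle begin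

text \<open>The triangles found in the directions of the two sides must be the same one, and the
  sides meet only at \<open>a\<close>.\<close>

lemma corner_triangle:
  assumes a: "a \<in> vertices \<Gamma>" "card (triangles_at \<Gamma> a) = 1" and sides: "side a b" "side a c"
    and meet: "closed_segment a b \<inter> closed_segment a c = {a}"
  obtains x y where "triangles_at \<Gamma> a = {{a, x, y}}" "x \<noteq> a" "x \<in> closed_segment a b"
    "y \<noteq> a" "y \<in> closed_segment a c"
proof -
  have sides': "side b a" "side c a" "a \<noteq> b" "a \<noteq> c" using sides side_commute by (auto simp: side_def)
  obtain A where A: "triangles_at \<Gamma> a = {A}" using a(2) by (auto simp: card_1_singleton_iff)
  obtain x x' where x: "{a, x, x'} \<in> triangles \<Gamma>" "x \<noteq> a" "x \<in> closed_segment a b" "x' \<noteq> a"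
    using triangle_in_direction[OF a(1) _ sides'(3) sides'(1)] by auto
  obtain y y' where y: "{a, y, y'} \<in> triangles \<Gamma>" "y \<noteq> a" "y \<in> closed_segment a c" "y' \<noteq> a"
    using triangle_in_direction[OF a(1) _ sides'(4) sides'(2)] by auto
  have A1: "A = {a, x, x'}" and A2: "A = {a, y, y'}"
  proof -
    have "{a, x, x'} \<in> triangles_at \<Gamma> a" "{a, y, y'} \<in> triangles_at \<Gamma> a"
      using x(1) y(1) by (simp_all add: triangles_at_def)
    then show "A = {a, x, x'}" "A = {a, y, y'}" unfolding A by simp_all
  qed
  have "x \<noteq> y" using x y meet by blast
  moreover have "y \<in> A" unfolding A2 by simp
  ultimately have "x' = y" using y(2) unfolding A1 by blast
  then have "triangles_at \<Gamma> a = {{a, x, y}}" using A A1 by simp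
  then show ?thesis using that x(2,3) y(2,3) by blast
qed

text \<open>The fan at \<open>x\<close> starts with the given triangle: the edge from
  \<open>x\<close> to \<open>a\<close> is the only one in its direction, and being on the boundary
  it lies in one triangle only.\<close>

lemma triangles_at_3_next:
  assumes side: "side a b" and x: "x \<in> open_segment a b" "x \<in> vertices \<Gamma>"
    and card: "card (triangles_at \<Gamma> x) = 3" and T: "{a, x, y} \<in> triangles \<Gamma>"
  obtains z x' where "triangles_at \<Gamma> x = {{a, x, y}, {x, y, z}, {x, z, x'}}"
    "x' \<noteq> x" "x' \<in> closed_segment x b" "y \<notin> closed_segment a b" "z \<notin> closed_segment a b" "z \<noteq> y"
proof -
  obtain p0 p1 q1 q0 where eq: "triangles_at \<Gamma> x = {{x, p0, p1}, {x, p1, q1}, {x, q1, q0}}"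
    and p: "p0 \<noteq> x" "p0 \<in> closed_segment x a" and q: "q0 \<noteq> x" "q0 \<in> closed_segment x b"
    and out: "p1 \<notin> closed_segment a b" "q1 \<notin> closed_segment a b" "p1 \<noteq> q1"
    using triangles_at_3[OF side x card] by metis
  have P: "{x, p0, p1} \<in> triangles \<Gamma>" using eq by (auto simp: triangles_at_def)
  have "a \<noteq> x" using x(1) by (auto simp: open_segment_def)
  have "p0 = a"
    using ray_unique[OF triangles_subset_face_sets[OF P, of "{x, p0}"] triangles_subset_face_sets[OF T, of "{x, a}"], of a]
      p \<open>a \<noteq> x\<close> by auto
  have "{x, p0, p1} = {a, x, y}"
    using boundary_edge_unique_triangle[OF P T, of "{x, a}" "closed_segment a b"] side side_proper
      x(1) \<open>a \<noteq> x\<close> \<open>p0 = a\<close> by (auto simp: side_def open_segment_def)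
  then have "p1 = y" using triangles_distinct[OF T] \<open>p0 = a\<close> by auto
  then show ?thesis using that[of q1 q0] eq q out \<open>p0 = a\<close> by (auto simp: insert_commute)
qed

end

section \<open>A triangle with named corners\<close>

locale triangulated_triangle_corners =
  fixes a b c :: "'a::euclidean_space" and \<Gamma> :: "'a set set"
  assumes corners: "\<not> affine_dependent {a, b, c}" "a \<noteq> b" "b \<noteq> c" "a \<noteq> c"
    and triangulates': "triangulates \<Gamma> (convex hull {a, b, c})"
begin

sublocale triangulated_triangle "convex hull {a, b, c}" \<Gamma>
proof
  show "2 simplex (convex hull {a, b, c})"
    unfolding simplex_def using corners by (intro exI[of _ "{a, b, c}"]) auto
qed (rule triangulates')

lemma sides: "side a b" "side b c" "side a c" "side b a" "side c b" "side c a"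
proof -
  have "closed_segment u v face_of convex hull {a, b, c}" if "{u, v} \<subseteq> {a, b, c}" for u v
    unfolding segment_convex_hull face_of_convex_hull_affine_independent[OF corners(1)]
    using that by blast
  then show "side a b" "side b c" "side a c" "side b a" "side c b" "side c a"
    using corners by (auto simp: side_def)
qed

lemma sides_meet:
  "closed_segment a b \<inter> closed_segment a c = {a}"
  "closed_segment b a \<inter> closed_segment b c = {b}"
  "closed_segment c a \<inter> closed_segment c b = {c}"
proof -
  have *: "closed_segment u v \<inter> closed_segment u w = {u}"
    if "{u, v, w} = {a, b, c}" "v \<noteq> w" for u v w
  proof -
    have "{u, v} \<inter> {u, w} = {u}" using that by auto
    then show ?thesis
      using convex_hull_Int_affine_independent[OF corners(1), of "{u, v}" "{u, w}"] that
      by (auto simp: segment_convex_hull)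
  qed
  show "closed_segment a b \<inter> closed_segment a c = {a}"
    "closed_segment b a \<inter> closed_segment b c = {b}"
    "closed_segment c a \<inter> closed_segment c b = {c}"
    using corners by (intro *; auto)+
qed

lemma corners_vertices: "{a, b, c} \<subseteq> vertices \<Gamma>"
proof
  fix v assume v: "v \<in> {a, b, c}"
  then have ext: "v extreme_point_of convex hull {a, b, c}"
    using extreme_point_of_convex_hull_affine_independent[OF corners(1)] by auto
  have "v \<in> convex hull {a, b, c}" using v hull_inc by metis
  then obtain A where A: "A \<in> triangles \<Gamma>" "v \<in> convex hull A" using point_in_triangles by blast
  have "v extreme_point_of convex hull A"
    using ext A(2) hull_subset_triangle[OF triangles_face_sets[OF A(1)]]
    unfolding extreme_point_of_def by blast
  then have "v \<in> A" by (rule extreme_point_of_convex_hull)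
  then show "v \<in> vertices \<Gamma>" using triangles_vertices[OF A(1)] by blast
qed

lemma permuted: "triangulated_triangle_corners b a c \<Gamma>" "triangulated_triangle_corners a c b \<Gamma>"
  using corners triangulates' by (auto simp: triangulated_triangle_corners_def insert_commute)

lemma triangle_eq_corners:
  assumes "{a, b, c} \<in> triangles \<Gamma>" shows "vertices \<Gamma> \<subseteq> {a, b, c}"
  using vertex_in_hull[OF complex triangles_face_sets[OF assms]] vertices_subset_triangle by blast

text \<open>If \<open>x = b\<close>, then \<open>{a, b, y}\<close> is the only triangle at
  \<open>b\<close> and so has an edge along the side from \<open>b\<close> to \<open>c\<close>. Its
  other end must be \<open>y\<close>, which forces \<open>y = c\<close>; then a single triangle
  fills \<open>\<Delta>\<close> and leaves no room for the vertex \<open>v\<close>.\<close>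

lemma corner_far_vertex:
  assumes card: "card (triangles_at \<Gamma> b) = 1" and eq: "{a, x, y} \<in> triangles \<Gamma>"
    and y: "y \<in> closed_segment a c" "y \<noteq> a" and v: "v \<in> vertices \<Gamma>" "v \<notin> {a, b, c}"
  shows "x \<noteq> b"
proof
  assume "x = b"
  have meet: "closed_segment b a \<inter> closed_segment b c = {b}" by (rule sides_meet)
  have bV: "b \<in> vertices \<Gamma>" using corners_vertices by simp
  obtain x' z where z: "triangles_at \<Gamma> b = {{b, x', z}}" "z \<noteq> b" "z \<in> closed_segment b c"
    using corner_triangle[OF bV card sides(4,2) meet] by metis
  have "{a, b, y} \<in> triangles_at \<Gamma> b" using eq \<open>x = b\<close> by (simp add: triangles_at_def)
  then have "{a, b, y} = {b, x', z}" using z(1) by simp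
  then have "z = a \<or> z = y" using z(2) by blast
  moreover have "a \<notin> closed_segment b c"
    using meet corners(2) by auto
  ultimately have "y \<in> closed_segment b c" using z(3) by auto
  then have "y = c" using y(1) sides_meet(3) by (auto simp: closed_segment_commute)
  then have "{a, b, c} \<in> triangles \<Gamma>" using eq \<open>x = b\<close> by simp
  then show False using triangle_eq_corners v by blast
qed

lemma trivial_if_no_other_vertices:
  assumes "vertices \<Gamma> \<subseteq> {a, b, c}"
  shows "\<Gamma> = trivial_subdivision (convex hull {a, b, c})"
proof -
  have *: "A = {a, b, c}" if "A \<in> triangles \<Gamma>" for A
  proof (rule card_subset_eq)
    show "A \<subseteq> {a, b, c}" using triangles_vertices[OF that] assms by blast
    show "card A = card {a, b, c}" using that corners by (simp add: triangles_def)
  qed simp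
  obtain A where A: "A \<in> triangles \<Gamma>" 
    using corners_vertices face_sets_singleton[OF complex, of a] face_sets_extend by blast
  have "triangles \<Gamma> = {{a, b, c}}" using * A by blast
  then show ?thesis using faces_eq by (simp add: trivial_subdivision_def)
qed

text \<open>The corner triangle at \<open>a\<close> cuts off points \<open>x\<close> and
  \<open>y\<close>. The fans at \<open>x\<close> and \<open>y\<close> share the triangle across
  their edge, whose third vertex \<open>z\<close> is on neither of their sides and hence on the
  third; the fan at \<open>z\<close> then forces the remaining two vertices to be \<open>b\<close>
  and \<open>c\<close>.\<close>

lemma trivial_or_triforce:
  assumes boundary: "vertices \<Gamma> \<subseteq> closed_segment a b \<union> closed_segment b c \<union> closed_segment a c"
    and corner: "card (triangles_at \<Gamma> a) = 1" "card (triangles_at \<Gamma> b) = 1" "card (triangles_at \<Gamma> c) = 1"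
    and noncorner: "\<And>v. v \<in> vertices \<Gamma> \<Longrightarrow> v \<notin> {a, b, c} \<Longrightarrow> card (triangles_at \<Gamma> v) = 3"
  shows "\<Gamma> = trivial_subdivision (convex hull {a, b, c}) \<or> triforce_subdivision (convex hull {a, b, c}) \<Gamma>"
proof (cases "vertices \<Gamma> \<subseteq> {a, b, c}")
  case True
  then show ?thesis using trivial_if_no_other_vertices by blast
next
  case False
  then obtain v where v: "v \<in> vertices \<Gamma>" "v \<notin> {a, b, c}" by blast
  interpret acb: triangulated_triangle_corners a c b \<Gamma> by (rule permuted)
  obtain x y where xy: "triangles_at \<Gamma> a = {{a, x, y}}" "x \<noteq> a" "x \<in> closed_segment a b"
    "y \<noteq> a" "y \<in> closed_segment a c"
    using corner_triangle[OF _ corner(1) sides(1,3) sides_meet(1)] corners_vertices by auto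
  have T1: "{a, x, y} \<in> triangles \<Gamma>" using xy(1) by (auto simp: triangles_at_def)
  then have T1': "{a, y, x} \<in> triangles \<Gamma>" by (simp add: insert_commute)
  have xb: "x \<noteq> b" by (rule corner_far_vertex[OF corner(2) T1 xy(5,4) v])
  have yc: "y \<noteq> c"
    by (rule acb.corner_far_vertex[OF corner(3) T1' xy(3,2)]) (use v in auto)
  have xV: "x \<in> vertices \<Gamma>" and yV: "y \<in> vertices \<Gamma>" using triangles_vertices[OF T1] by auto
  have xo: "x \<in> open_segment a b" and yo: "y \<in> open_segment a c"
    using xy xb yc by (auto simp: open_segment_def)
  have x_ac: "x \<notin> closed_segment a c" and y_ab: "y \<notin> closed_segment a b"
    using xy sides_meet(1) by auto
  have x_bc: "x \<notin> closed_segment b c" and y_bc: "y \<notin> closed_segment b c"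
    using xy xb yc sides_meet by (auto simp: closed_segment_commute)
  have card_x: "card (triangles_at \<Gamma> x) = 3" and card_y: "card (triangles_at \<Gamma> y) = 3"
  proof -
    have "x \<notin> {a, b, c}" "y \<notin> {a, b, c}" using xy xb yc x_ac y_ab by auto
    then show "card (triangles_at \<Gamma> x) = 3" "card (triangles_at \<Gamma> y) = 3"
      using noncorner xV yV by auto
  qed
  obtain z x' where z: "triangles_at \<Gamma> x = {{a, x, y}, {x, y, z}, {x, z, x'}}"
    "x' \<noteq> x" "x' \<in> closed_segment x b" "z \<notin> closed_segment a b"
    using triangles_at_3_next[OF sides(1) xo xV card_x T1] by metis
  obtain z2 y' where z2: "triangles_at \<Gamma> y = {{a, y, x}, {y, x, z2}, {y, z2, y'}}"
    "y' \<noteq> y" "y' \<in> closed_segment y c" "z2 \<notin> closed_segment a c" "z2 \<noteq> x"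
    using triangles_at_3_next[OF sides(3) yo yV card_y T1'] by metis
  have x'ab: "x' \<in> closed_segment a b"
    using z(3) xy(3) closed_segment_subset[of x "closed_segment a b" b] by auto
  have y'ac: "y' \<in> closed_segment a c"
    using z2(3) xy(5) closed_segment_subset[of y "closed_segment a c" c] by auto
  have T2: "{x, y, z} \<in> triangles \<Gamma>" and T3: "{x, z, x'} \<in> triangles \<Gamma>" 
    using z(1) by (auto simp: triangles_at_def)
  note d2 = triangles_distinct[OF T2] and d3 = triangles_distinct[OF T3]
  have "{x, y, z} \<in> triangles_at \<Gamma> y" using T2 by (simp add: triangles_at_def)
  moreover have "{x, y, z} \<noteq> {a, y, x}" using z(4) d2 by auto
  \<comment> \<open>Of the three triangles at \<open>y\<close> only the middle one can be
    \<open>{x, y, z}\<close>; this identifies \<open>z2\<close> with \<open>z\<close>.\<close>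
  moreover have "{x, y, z} \<noteq> {y, z2, y'}"
  proof
    assume "{x, y, z} = {y, z2, y'}"
    then have "x = y'" using d2 z2(5) by blast
    then show False using y'ac x_ac by simp
  qed
  ultimately have "{x, y, z} = {y, x, z2}" using z2(1) by auto
  moreover have "z2 \<noteq> y" using z2(4) xy(5) by auto
  ultimately have zz: "z2 = z" using z2(5) by blast
  have T4: "{y, z, y'} \<in> triangles \<Gamma>" using z2(1) zz by (auto simp: triangles_at_def)
  note d4 = triangles_distinct[OF T4]
  have zV: "z \<in> vertices \<Gamma>" using triangles_vertices[OF T2] by auto
  then have "z \<in> closed_segment b c" using boundary z(4) z2(4) zz by auto
  moreover have zbc: "z \<noteq> b" "z \<noteq> c" using z(4) z2(4) zz by auto
  ultimately have zo: "z \<in> open_segment b c" by (simp add: open_segment_def)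
  have "z \<notin> {a, b, c}" using z(4) zbc by auto
  then have card_z: "card (triangles_at \<Gamma> z) = 3" using noncorner zV by blast
  obtain p0 p1 q1 q0 where eq: "triangles_at \<Gamma> z = {{z, p0, p1}, {z, p1, q1}, {z, q1, q0}}"
    and p: "p0 \<noteq> z" "p0 \<in> closed_segment z b" and q: "q0 \<noteq> z" "q0 \<in> closed_segment z c"
    and out: "p1 \<notin> closed_segment b c" "q1 \<notin> closed_segment b c"
    using triangles_at_3[OF sides(2) zo zV card_z] by metis
  have pq: "p0 \<in> closed_segment b c" "q0 \<in> closed_segment b c"
    using p q \<open>z \<in> closed_segment b c\<close> closed_segment_subset[of z "closed_segment b c" b]
      closed_segment_subset[of z "closed_segment b c" c] by auto
  have zat: "{x, y, z} \<in> triangles_at \<Gamma> z" "{x, z, x'} \<in> triangles_at \<Gamma> z" "{y, z, y'} \<in> triangles_at \<Gamma> z"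
    using T2 T3 T4 by (auto simp: triangles_at_def)
  have ne: "{x, y, z} \<noteq> {x, z, x'}" "{x, y, z} \<noteq> {y, z, y'}" "{x, z, x'} \<noteq> {y, z, y'}"
  proof -
    have "y \<notin> {x, z, x'}" using d2 x'ab y_ab by auto
    then show "{x, y, z} \<noteq> {x, z, x'}" "{x, z, x'} \<noteq> {y, z, y'}" by blast+
    have "x \<notin> {y, z, y'}" using d2 y'ac x_ac by auto
    then show "{x, y, z} \<noteq> {y, z, y'}" by blast
  qed
  \<comment> \<open>The outer triangles of the fan at \<open>z\<close> have an edge on the side from
    \<open>b\<close> to \<open>c\<close>, but \<open>x\<close> and \<open>y\<close> are off that
    side. So \<open>{x, y, z}\<close> is in the middle.\<close>
  have "p0 \<notin> {x, y, z}" "q0 \<notin> {x, y, z}" using p q pq x_bc y_bc by auto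
  then have "{x, y, z} \<noteq> {z, p0, p1}" "{x, y, z} \<noteq> {z, q1, q0}" by blast+
  then have mid: "{x, y, z} = {z, p1, q1}"
    using zat(1) unfolding eq insert_iff empty_iff by meson
  \<comment> \<open>Every other triangle at \<open>z\<close> has a further vertex on this side. For
    \<open>{x, z, x'}\<close> it can only be \<open>x'\<close>, which is also on the side from
    \<open>a\<close> to \<open>b\<close>, hence \<open>x' = b\<close>; similarly
    \<open>y' = c\<close>.\<close>
  have hit: "\<exists>r\<in>A. r \<noteq> z \<and> r \<in> closed_segment b c" if "A \<in> triangles_at \<Gamma> z" "A \<noteq> {x, y, z}" for A
    using that eq mid p q pq by auto
  have x'b: "x' = b"
    using hit[OF zat(2)] ne x_bc x'ab sides_meet(2) by (auto simp: closed_segment_commute)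
  have y'c: "y' = c"
    using hit[OF zat(3)] ne y_bc y'ac sides_meet(3) by (auto simp: closed_segment_commute)
  have at_z: "triangles_at \<Gamma> z = {{x, y, z}, {x, z, x'}, {y, z, y'}}"
  proof (rule card_subset_eq[OF finite_triangles_at, symmetric])
    show "{{x, y, z}, {x, z, x'}, {y, z, y'}} \<subseteq> triangles_at \<Gamma> z" using zat by simp
    show "card {{x, y, z}, {x, z, x'}, {y, z, y'}} = card (triangles_at \<Gamma> z)"
      using ne card_z by simp
  qed
  have at_b: "triangles_at \<Gamma> b = {{x, z, b}}"
  proof -
    have "{x, z, b} \<in> triangles_at \<Gamma> b" using T3 x'b by (simp add: triangles_at_def)
    then show ?thesis using corner(2) by (metis card_1_singletonE singletonD)
  qed
  have at_c: "triangles_at \<Gamma> c = {{y, z, c}}"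
  proof -
    have "{y, z, c} \<in> triangles_at \<Gamma> c" using T4 y'c by (simp add: triangles_at_def)
    then show ?thesis using corner(3) by (metis card_1_singletonE singletonD)
  qed
  have V: "vertices \<Gamma> \<subseteq> {a, b, c, x, y, z}"
  proof
    fix u assume u: "u \<in> vertices \<Gamma>"
    have *: "u \<in> A" if "A \<in> triangles \<Gamma>" "r \<in> A" "s \<in> A" "u \<in> closed_segment r s" for A r s
    proof -
      have "u \<in> convex hull A"
        using that hull_mono[of "{r, s}" A convex] by (auto simp: segment_convex_hull)
      then show ?thesis using vertex_in_hull[OF complex triangles_face_sets[OF that(1)] u] by blast
    qed
    \<comment> \<open>The points \<open>x\<close>, \<open>y\<close>, \<open>z\<close> divide the
      sides into six segments, each an edge of a known triangle and thus without further
      vertices.\<close>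
    have "u \<in> closed_segment x a \<or> u \<in> closed_segment x b \<or> u \<in> closed_segment z b \<or> u \<in> closed_segment z c \<or>
        u \<in> closed_segment y a \<or> u \<in> closed_segment y c"
      using boundary u closed_segment_cases[OF xy(3)] closed_segment_cases[OF xy(5)]
        closed_segment_cases[OF \<open>z \<in> closed_segment b c\<close>] by blast
    then show "u \<in> {a, b, c, x, y, z}"
      using *[OF T1, of x a] *[OF T1, of y a] *[OF T3, of x b] *[OF T3, of z b]
        *[OF T4, of y c] *[OF T4, of z c] x'b y'c by auto
  qed
  have tri: "triangles \<Gamma> = {{a, y, x}, {b, x, z}, {c, z, y}, {x, y, z}}"
  proof
    let ?R = "{{a, y, x}, {b, x, z}, {c, z, y}, {x, y, z}}"
    show "triangles \<Gamma> \<subseteq> ?R"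
    proof
      fix A assume A: "A \<in> triangles \<Gamma>"
      then obtain u where u: "u \<in> A" by (auto simp: triangles_def card_Suc_eq numeral_3_eq_3)
      have perm: "{a, x, y} = {a, y, x}" "{x, z, b} = {b, x, z}" "{y, z, c} = {c, z, y}" "{y, x, z} = {x, y, z}"
        by auto
      have "triangles_at \<Gamma> a \<subseteq> ?R" unfolding xy(1) perm by simp
      moreover have "triangles_at \<Gamma> b \<subseteq> ?R" unfolding at_b perm by simp
      moreover have "triangles_at \<Gamma> c \<subseteq> ?R" unfolding at_c perm by simp
      moreover have "triangles_at \<Gamma> x \<subseteq> ?R" unfolding z(1) x'b perm by simp
      moreover have "triangles_at \<Gamma> y \<subseteq> ?R" unfolding z2(1) zz y'c perm by simp
      moreover have "triangles_at \<Gamma> z \<subseteq> ?R" unfolding at_z x'b y'c perm by simp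
      moreover have "u \<in> {a, b, c, x, y, z}" using V triangles_vertices[OF A] u by blast
      ultimately have "triangles_at \<Gamma> u \<subseteq> ?R" by (elim insertE emptyE) simp_all
      moreover have "A \<in> triangles_at \<Gamma> u" using A u by (simp add: triangles_at_def)
      ultimately show "A \<in> ?R" by (rule subsetD)
    qed
    show "{{a, y, x}, {b, x, z}, {c, z, y}, {x, y, z}} \<subseteq> triangles \<Gamma>"
      using T1 T2 T3 T4 x'b y'c by (auto simp: insert_commute)
  qed
  have "triforce_subdivision (convex hull {a, b, c}) \<Gamma>"
    unfolding triforce_subdivision_def
  proof (intro exI conjI)
    show "card {a, b, c} = 3" using corners by auto
    \<comment> \<open>The points \<open>p\<close>, \<open>q\<close>, \<open>r\<close> of the
      definition are \<open>z\<close>, \<open>y\<close>, \<open>x\<close>.\<close>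
    show "\<Gamma> = {F. \<exists>T \<in> {convex hull {a, x, y}, convex hull {b, z, x},
                        convex hull {c, y, z}, convex hull {z, y, x}}. F face_of T}"
      using faces_eq unfolding tri by (simp add: insert_commute)
  qed (use corners zo yo xo in auto)
  then show ?thesis ..
qed

end

section \<open>Merging two triangles\<close>

context triangulated_triangle begin

text \<open>A relative interior point of the hull of \<open>C\<close> is in one of the two hulls,
  and that one then contains all of \<open>C\<close>.\<close>

lemma face_sets_subset_cases:
  assumes C: "C \<in> face_sets \<Gamma>" and AB: "A \<in> face_sets \<Gamma>" "B \<in> face_sets \<Gamma>"
    and sub: "convex hull C \<subseteq> convex hull A \<union> convex hull B"
  shows "C \<subseteq> A \<or> C \<subseteq> B"
proof (cases "C = {}")
  case False
  then obtain x where x: "x \<in> rel_interior (convex hull C)"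
    using rel_interior_eq_empty[of "convex hull C"] by auto
  then have "x \<in> convex hull A \<or> x \<in> convex hull B" using sub rel_interior_subset by blast
  then show ?thesis using face_sets_subsetI[OF complex C _ x] AB by blast
qed simp

lemma restriction_face:
  assumes "H \<in> \<Gamma>" shows "restriction \<Gamma> H = trivial_subdivision H"
proof (intro set_eqI iffI)
  fix S assume "S \<in> restriction \<Gamma> H"
  then have S: "S \<in> \<Gamma>" "S \<subseteq> H" by (auto simp: restriction_def)
  then have "H \<inter> S face_of H" using complex assms unfolding simplicial_complex_def by blast
  then show "S \<in> trivial_subdivision H" using S(2) by (simp add: trivial_subdivision_def Int_absorb1)
next
  fix S assume "S \<in> trivial_subdivision H"
  then have S: "S face_of H" by (simp add: trivial_subdivision_def)
  then have "S \<in> \<Gamma>" using complex assms unfolding simplicial_complex_def by blast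
  then show "S \<in> restriction \<Gamma> H" using face_of_imp_subset[OF S] by (simp add: restriction_def)
qed

text \<open>The coarser triangulation replaces everything at \<open>v\<close> by the triangle
  \<open>D\<close>, in which \<open>v\<close> lies on the edge opposite to \<open>w\<close>. Seen
  from \<open>D\<close>, the given triangulation is the cone with apex \<open>w\<close> over that
  edge divided at \<open>v\<close>.\<close>

lemma merge_triangles:
  assumes side: "side b c" and v: "v \<in> open_segment b c" "v \<in> vertices \<Gamma>"
    and card: "card (triangles_at \<Gamma> v) \<le> 2"
  obtains \<Gamma>' where "triangulates \<Gamma>' \<Delta>" "vertices \<Gamma>' = vertices \<Gamma> - {v}"
    "card (triangles \<Gamma>') + 1 \<le> card (triangles \<Gamma>)" "conical_facet_refinement \<Delta> \<Gamma>' \<Gamma>"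
proof -
  let ?F = "closed_segment b c"
  obtain w p q where eq: "triangles_at \<Gamma> v = {{v, w, p}, {v, w, q}}"
    and p: "p \<noteq> v" "p \<in> closed_segment v b" and q: "q \<noteq> v" "q \<in> closed_segment v c" and w: "w \<notin> ?F"
    using triangles_at_2[OF side v card] by metis
  define D where "D = {w, p, q}"
  \<comment> \<open>Only \<open>{p, q}\<close> and \<open>D\<close> have to be added: all other
    subsets of \<open>D\<close> are faces of the old triangles at \<open>v\<close>.\<close>
  define K where "K = {C \<in> face_sets \<Gamma>. v \<notin> C} \<union> {{p, q}, D}"
  define \<Gamma>' where "\<Gamma>' = (hull) convex ` K"
  have F: "?F face_of \<Delta>" using side by (simp add: side_def)
  have vF: "v \<in> ?F" using v(1) by (auto simp: open_segment_def)
  have pF: "p \<in> ?F" using p(2) vF closed_segment_subset[of v ?F b] by auto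
  have qF: "q \<in> ?F" using q(2) vF closed_segment_subset[of v ?F c] by auto
  have T: "{v, w, p} \<in> triangles \<Gamma>" "{v, w, q} \<in> triangles \<Gamma>" using eq by (auto simp: triangles_at_def)
  note Tf = T[THEN triangles_face_sets]
  have pq: "p \<noteq> q" using closed_segment_meet[OF vF] p q by blast
  have dist: "v \<noteq> w" "w \<noteq> p" "w \<noteq> q" using vF pF qF w by auto
  have v_seg: "v \<in> closed_segment p q" by (rule between_rays[OF v(1) p(2,1) q(2,1)])
  have indD: "\<not> affine_dependent D"
    unfolding D_def
  proof (rule affine_independent_insert[OF affine_independent_2])
    show "w \<notin> affine hull {p, q}"
    proof
      assume "w \<in> affine hull {p, q}"
      then have "w \<in> affine hull ?F" using hull_mono[of "{p, q}" ?F affine] pF qF by auto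
      moreover have "w \<in> \<Delta>" using face_sets_subset_triangle[OF Tf(1)] by auto
      ultimately show False using face_of_imp_eq_affine_Int[OF convex_triangle F] w by blast
    qed
  qed
  have cardD: "card D = 3" using dist pq by (simp add: D_def)
  have hullD: "convex hull D = convex hull {v, w, p} \<union> convex hull {v, w, q}"
    unfolding D_def by (rule convex_hull_split[OF v_seg])
  have sub_pq: "convex hull {p, q} \<subseteq> convex hull D" by (rule hull_mono) (simp add: D_def)
  have split_pq: "convex hull {p, q} = convex hull {v, p} \<union> convex hull {v, q}"
    using Un_closed_segment[OF v_seg] by (simp add: segment_convex_hull insert_commute)
  \<comment> \<open>The intersection is computed in each half of \<open>D\<close>. An old face
    without \<open>v\<close> cannot contain both \<open>p\<close> and \<open>q\<close>, since
    \<open>v\<close> would be in its hull; hence one of the two partial intersections contains the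
    other.\<close>
  have Int_D: "convex hull C \<inter> convex hull D = convex hull (C \<inter> D)"
    if C: "C \<in> face_sets \<Gamma>" "v \<notin> C" for C
  proof -
    have i: "convex hull C \<inter> convex hull {v, w, p} = convex hull (C \<inter> {w, p})"
      "convex hull C \<inter> convex hull {v, w, q} = convex hull (C \<inter> {w, q})"
      using face_sets_Int[OF complex C(1) Tf(1)] face_sets_Int[OF complex C(1) Tf(2)] C(2) by simp_all
    have "p \<notin> C \<or> q \<notin> C"
    proof (rule ccontr)
      assume "\<not> (p \<notin> C \<or> q \<notin> C)"
      then have "v \<in> convex hull C"
        using v_seg hull_mono[of "{p, q}" C convex] by (auto simp: segment_convex_hull)
      then show False using vertex_in_hull[OF complex C(1) v(2)] C(2) by blast
    qed
    then consider "p \<notin> C" | "q \<notin> C" by blast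
    then have "convex hull (C \<inter> {w, p}) \<union> convex hull (C \<inter> {w, q}) = convex hull (C \<inter> D)"
    proof cases
      case 1
      then have "C \<inter> {w, p} \<subseteq> C \<inter> {w, q}" "C \<inter> D = C \<inter> {w, q}" by (auto simp: D_def)
      then show ?thesis using hull_mono[of "C \<inter> {w, p}" "C \<inter> {w, q}" convex] by (simp add: Un_absorb1)
    next
      case 2
      then have "C \<inter> {w, q} \<subseteq> C \<inter> {w, p}" "C \<inter> D = C \<inter> {w, p}" by (auto simp: D_def)
      then show ?thesis using hull_mono[of "C \<inter> {w, q}" "C \<inter> {w, p}" convex] by (simp add: Un_absorb2)
    qed
    then show ?thesis unfolding hullD Int_Un_distrib i .
  qed
  have indK: "\<not> affine_dependent A" if "A \<in> K" for A
    using that indD affine_independent_2[of p q] by (auto simp: K_def face_sets_def)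
  have old: "B \<in> K" if "B \<subseteq> {w, p} \<or> B \<subseteq> {w, q}" for B
  proof -
    have "B \<subseteq> {v, w, p} \<or> B \<subseteq> {v, w, q}" using that by auto
    then have "B \<in> face_sets \<Gamma>" using face_sets_subset[OF complex] Tf by blast
    moreover have "v \<notin> B" using that dist p q by auto
    ultimately show ?thesis by (simp add: K_def)
  qed
  have KD: "A \<subseteq> D" if "A \<in> K" "\<not> (A \<in> face_sets \<Gamma> \<and> v \<notin> A)" for A
    using that by (auto simp: K_def D_def)
  have complex': "simplicial_complex \<Gamma>'"
    unfolding \<Gamma>'_def
  proof (rule simplicial_complexI)
    show "finite K" using finite_face_sets[OF complex] by (simp add: K_def)
    show "\<not> affine_dependent A" if "A \<in> K" for A by (rule indK[OF that])
    show "B \<in> K" if "A \<in> K" "B \<subseteq> A" for A B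
    proof (cases "A \<in> face_sets \<Gamma> \<and> v \<notin> A")
      case True
      then have "B \<in> face_sets \<Gamma>" "v \<notin> B" using face_sets_subset[OF complex] that by blast+
      then show ?thesis by (simp add: K_def)
    next
      case False
      then have "B \<subseteq> D" using KD that by blast
      show ?thesis
      proof (cases "{p, q} \<subseteq> B")
        case True
        then have "B = {p, q} \<or> B = D" using \<open>B \<subseteq> D\<close> unfolding D_def by blast
        then show ?thesis unfolding K_def by blast
      next
        case False
        then have "B \<subseteq> {w, p} \<or> B \<subseteq> {w, q}" using \<open>B \<subseteq> D\<close> unfolding D_def by blast
        then show ?thesis by (rule old)
      qed
    qed
    \<comment> \<open>Intersecting with \<open>D\<close> first moves the question into a single
      simplex.\<close>
    have mixed: "convex hull A \<inter> convex hull B \<subseteq> convex hull (A \<inter> B)"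
      if A: "A \<in> face_sets \<Gamma>" "v \<notin> A" and B: "B \<subseteq> D" for A B
    proof -
      have "convex hull A \<inter> convex hull B \<subseteq> (convex hull A \<inter> convex hull D) \<inter> convex hull B"
        using hull_mono[OF B] by blast
      also have "\<dots> = convex hull (A \<inter> D \<inter> B)"
        unfolding Int_D[OF A] by (rule convex_hull_Int_affine_independent[OF indD]) (use B in auto)
      also have "A \<inter> D \<inter> B = A \<inter> B" using B by auto
      finally show ?thesis .
    qed
    show "convex hull A \<inter> convex hull B \<subseteq> convex hull (A \<inter> B)" if "A \<in> K" "B \<in> K" for A B
    proof (cases "A \<in> face_sets \<Gamma> \<and> v \<notin> A"; cases "B \<in> face_sets \<Gamma> \<and> v \<notin> B")
      assume "A \<in> face_sets \<Gamma> \<and> v \<notin> A" "B \<in> face_sets \<Gamma> \<and> v \<notin> B"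
      then show ?thesis using face_sets_Int[OF complex, of A B] by simp
    next
      assume "A \<in> face_sets \<Gamma> \<and> v \<notin> A" "\<not> (B \<in> face_sets \<Gamma> \<and> v \<notin> B)"
      then show ?thesis using mixed KD[OF that(2)] by blast
    next
      assume "\<not> (A \<in> face_sets \<Gamma> \<and> v \<notin> A)" "B \<in> face_sets \<Gamma> \<and> v \<notin> B"
      then show ?thesis using mixed[of B A] KD[OF that(1)] by (simp add: Int_commute)
    next
      assume "\<not> (A \<in> face_sets \<Gamma> \<and> v \<notin> A)" "\<not> (B \<in> face_sets \<Gamma> \<and> v \<notin> B)"
      then show ?thesis
        using convex_hull_Int_affine_independent[OF indD KD[OF that(1)] KD[OF that(2)]] by simp
    qed
  qed
  have fs': "face_sets \<Gamma>' = K"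
  proof
    show "K \<subseteq> face_sets \<Gamma>'" using indK by (auto simp: face_sets_def \<Gamma>'_def)
    show "face_sets \<Gamma>' \<subseteq> K"
    proof
      fix A assume "A \<in> face_sets \<Gamma>'"
      then obtain B where "\<not> affine_dependent A" "B \<in> K" "convex hull A = convex hull B"
        by (auto simp: face_sets_def \<Gamma>'_def)
      then show "A \<in> K" using convex_hull_inj_affine_independent indK by blast
    qed
  qed
  have empty: "{} \<in> \<Gamma>" using triangulates by (simp add: triangulates_def)
  have DD: "convex hull D \<subseteq> \<Delta>" using hullD Tf hull_subset_triangle by auto
  have triangulates': "triangulates \<Gamma>' \<Delta>"
    unfolding triangulates_def
  proof (intro conjI complex')
    show "\<Union> \<Gamma>' = \<Delta>"
    proof
      show "\<Union> \<Gamma>' \<subseteq> \<Delta>"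
        using hull_subset_triangle DD sub_pq by (auto simp: \<Gamma>'_def K_def)
      show "\<Delta> \<subseteq> \<Union> \<Gamma>'"
      proof
        fix x assume "x \<in> \<Delta>"
        then obtain A where A: "A \<in> triangles \<Gamma>" "x \<in> convex hull A" using point_in_triangles by blast
        show "x \<in> \<Union> \<Gamma>'"
        proof (cases "v \<in> A")
          case True
          then have "A \<in> triangles_at \<Gamma> v" using A by (simp add: triangles_at_def)
          then have "x \<in> convex hull D" using A(2) eq hullD by auto
          then show ?thesis by (auto simp: \<Gamma>'_def K_def)
        next
          case False
          then show ?thesis using A triangles_face_sets by (auto simp: \<Gamma>'_def K_def)
        qed
      qed
    qed
    have "{} \<in> K" using old by blast
    then show "{} \<in> \<Gamma>'" unfolding \<Gamma>'_def by (metis convex_hull_empty image_eqI)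
  qed
  interpret new: triangulated_triangle \<Delta> \<Gamma>'
    by unfold_locales (rule simplex triangulates')+
  have vertices': "vertices \<Gamma>' = vertices \<Gamma> - {v}"
  proof (intro set_eqI)
    fix x
    have "{x} \<noteq> {p, q}" "{x} \<noteq> D" using pq by (auto simp: D_def)
    then have "{x} \<in> K \<longleftrightarrow> {x} \<in> face_sets \<Gamma> \<and> x \<noteq> v" by (auto simp: K_def)
    then show "x \<in> vertices \<Gamma>' \<longleftrightarrow> x \<in> vertices \<Gamma> - {v}"
      using face_sets_singleton[OF complex] face_sets_singleton[OF complex'] fs' by auto
  qed
  \<comment> \<open>Two triangles disappear and at most one is added.\<close>
  have "card (triangles \<Gamma>') + 1 \<le> card (triangles \<Gamma>)"
  proof -
    have "triangles \<Gamma>' \<subseteq> insert D (triangles \<Gamma> - {{v, w, p}, {v, w, q}})"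
    proof
      fix A assume "A \<in> triangles \<Gamma>'"
      then have "A \<in> K" "card A = 3" by (auto simp: triangles_def fs')
      moreover have "A \<noteq> {p, q}" using \<open>card A = 3\<close> by (auto simp: card_insert_if split: if_splits)
      ultimately show "A \<in> insert D (triangles \<Gamma> - {{v, w, p}, {v, w, q}})"
        by (auto simp: K_def triangles_def)
    qed
    then have "card (triangles \<Gamma>') \<le> card (insert D (triangles \<Gamma> - {{v, w, p}, {v, w, q}}))"
      using finite_triangles[OF complex] by (intro card_mono) auto
    also have "\<dots> \<le> Suc (card (triangles \<Gamma> - {{v, w, p}, {v, w, q}}))"
      using finite_triangles[OF complex] by (simp add: card_insert_if)
    also have "card (triangles \<Gamma> - {{v, w, p}, {v, w, q}}) = card (triangles \<Gamma>) - 2"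
    proof -
      have "{v, w, p} \<noteq> {v, w, q}" using pq p q dist by (auto simp: doubleton_eq_iff)
      then show ?thesis using T by (subst card_Diff_subset) auto
    qed
    moreover have "2 \<le> card (triangles \<Gamma>)"
    proof -
      have "{v, w, p} \<noteq> {v, w, q}" using pq p q dist by (auto simp: doubleton_eq_iff)
      then have "card {{v, w, p}, {v, w, q}} = 2" by simp
      then show ?thesis using T finite_triangles[OF complex] card_mono[of "triangles \<Gamma>" "{{v, w, p}, {v, w, q}}"] by simp
    qed
    ultimately show ?thesis by simp
  qed
  moreover have "conical_facet_refinement \<Delta> \<Gamma>' \<Gamma>"
  proof -
    have old_faces: "S \<in> \<Gamma>" if "S \<in> \<Gamma>'" "S \<noteq> convex hull D" "S \<noteq> convex hull {p, q}" for S
      using that by (auto simp: \<Gamma>'_def K_def face_sets_def)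
    have G: "convex hull D \<in> \<Gamma>'" by (auto simp: \<Gamma>'_def K_def)
    have "refinement \<Delta> \<Gamma>' \<Gamma>"
      unfolding refinement_def
    proof (intro conjI triangulates triangulates' ballI)
      fix S assume S: "S \<in> \<Gamma>'"
      consider "S \<in> \<Gamma>" | "S = convex hull D" | "S = convex hull {p, q}" using old_faces[OF S] by blast
      then show "\<exists>\<A>\<subseteq>\<Gamma>. S = \<Union> \<A>"
      proof cases
        case 1 then show ?thesis by (intro exI[of _ "{S}"]) auto
      next
        case 2
        then show ?thesis using Tf hullD
          by (intro exI[of _ "{convex hull {v, w, p}, convex hull {v, w, q}}"]) (auto simp: face_sets_def)
      next
        case 3
        have "{v, p} \<in> face_sets \<Gamma>" "{v, q} \<in> face_sets \<Gamma>"
          using T by (auto intro: triangles_subset_face_sets)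
        then show ?thesis using 3 split_pq
          by (intro exI[of _ "{convex hull {v, p}, convex hull {v, q}}"]) (auto simp: face_sets_def)
      qed
    qed
    moreover have "is_facet \<Gamma>' (convex hull D)"
      unfolding is_facet_def
    proof (intro conjI G ballI impI)
      fix S assume S: "S \<in> \<Gamma>'" "convex hull D \<subseteq> S"
      obtain C where C: "C \<in> face_sets \<Gamma>'" "S = convex hull C" using face_setsE[OF complex' S(1)] by blast
      have "D \<in> face_sets \<Gamma>'" by (simp add: fs' K_def)
      then have "D \<subseteq> C"
        using new.face_sets_subset_cases[of D C C] C S(2) by simp
      moreover have "card C \<le> card D" using new.card_face_sets[OF C(1)] cardD by simp
      moreover have "finite C" using C(1) aff_independent_finite by (auto simp: face_sets_def)
      ultimately have "D = C" using card_seteq by blast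
      then show "S = convex hull D" using C by simp
    qed
    moreover have "restriction \<Gamma> H = trivial_subdivision H"
      if H: "is_facet \<Gamma>' H" "H \<noteq> convex hull D" for H
    proof (rule restriction_face, rule old_faces)
      show "H \<in> \<Gamma>'" using H by (simp add: is_facet_def)
      \<comment> \<open>The new edge is properly contained in \<open>D\<close> and is not maximal,
        so every facet other than \<open>D\<close> is an old face.\<close>
      show "H \<noteq> convex hull {p, q}" using H G sub_pq unfolding is_facet_def by blast
    qed (rule H(2))
    ultimately have fr: "facet_refinement \<Delta> (convex hull D) \<Gamma>' \<Gamma>"
      unfolding facet_refinement_def by blast
    have H1: "convex hull {p, q} face_of convex hull D"
      unfolding face_of_convex_hull_affine_independent[OF indD] by (intro exI[of _ "{p, q}"]) (auto simp: D_def)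
    have H2: "aff_dim (convex hull {p, q}) = aff_dim (convex hull D) - 1"
      using aff_dim_affine_independent[OF indD] cardD pq by (simp add: aff_dim_convex_hull aff_dim_2)
    have H3: "w extreme_point_of convex hull D"
      unfolding extreme_point_of_convex_hull_affine_independent[OF indD] by (simp add: D_def)
    have H4: "w \<notin> convex hull {p, q}"
      using w closed_segment_subset[OF pF qF] by (auto simp: segment_convex_hull)
    have "restriction \<Gamma> (convex hull D) = cone_over w (restriction \<Gamma> (convex hull {p, q}))"
    proof (intro set_eqI iffI)
      fix S assume "S \<in> restriction \<Gamma> (convex hull D)"
      then have S: "S \<in> \<Gamma>" "S \<subseteq> convex hull D" by (auto simp: restriction_def)
      obtain C where C: "C \<in> face_sets \<Gamma>" "S = convex hull C" using face_setsE[OF complex S(1)] by blast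
      have "C \<subseteq> {v, w, p} \<or> C \<subseteq> {v, w, q}"
        using face_sets_subset_cases[OF C(1) Tf] S C hullD by simp
      \<comment> \<open>Without the apex, an old face inside \<open>D\<close> lies on one of the two
        halves of the edge from \<open>p\<close> to \<open>q\<close>.\<close>
      then have sub: "C - {w} \<subseteq> {v, p} \<or> C - {w} \<subseteq> {v, q}" by blast
      then have "convex hull (C - {w}) \<subseteq> convex hull {p, q}"
        unfolding split_pq using hull_mono by blast
      moreover have "C - {w} \<in> face_sets \<Gamma>" by (rule face_sets_subset[OF complex C(1)]) auto
      ultimately have base: "convex hull (C - {w}) \<in> restriction \<Gamma> (convex hull {p, q})"
        by (simp add: restriction_def face_sets_def)
      show "S \<in> cone_over w (restriction \<Gamma> (convex hull {p, q}))"
      proof (cases "w \<in> C")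
        case True
        then have "S = convex hull (insert w (convex hull (C - {w})))"
          using C(2) hull_insert[of convex w "C - {w}"] by (simp add: insert_absorb)
        then show ?thesis using base unfolding cone_over_def by blast
      next
        case False
        then show ?thesis using base C(2) unfolding cone_over_def by simp
      qed
    next
      fix S assume "S \<in> cone_over w (restriction \<Gamma> (convex hull {p, q}))"
      then obtain S' where S': "S' \<in> \<Gamma>" "S' \<subseteq> convex hull {p, q}" "S = S' \<or> S = convex hull (insert w S')"
        by (auto simp: cone_over_def restriction_def)
      obtain C where C: "C \<in> face_sets \<Gamma>" "S' = convex hull C" using face_setsE[OF complex S'(1)] by blast
      have "{v, p} \<in> face_sets \<Gamma>" "{v, q} \<in> face_sets \<Gamma>"
        using T by (auto intro: triangles_subset_face_sets)
      then have "C \<subseteq> {v, p} \<or> C \<subseteq> {v, q}"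
        using face_sets_subset_cases[OF C(1)] S'(2) C(2) split_pq by simp
      then have wC: "insert w C \<subseteq> {v, w, p} \<or> insert w C \<subseteq> {v, w, q}" by blast
      then have "insert w C \<in> face_sets \<Gamma>" using face_sets_subset[OF complex] Tf by blast
      moreover have "convex hull (insert w C) \<subseteq> convex hull D"
        unfolding hullD using wC hull_mono by blast
      moreover have "convex hull (insert w S') = convex hull (insert w C)"
        using hull_insert[of convex w C] C(2) by simp
      ultimately show "S \<in> restriction \<Gamma> (convex hull D)"
        using S' sub_pq by (auto simp: restriction_def face_sets_def)
    qed
    then show ?thesis
      unfolding conical_facet_refinement_def using fr H1 H2 H3 H4 by blast
  qed
  ultimately show ?thesis using that triangulates' vertices' by blast
qed

end

section \<open>The local h-polynomial\<close>

text \<open>Comparison of the coefficients of x^k: the power with exponent n contributes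
  \<open>n choose k\<close>, and on the right the exponent \<open>d - i\<close> equals k only for
  \<open>i = d - k\<close>.\<close>

lemma is_h_poly_coeff:
  assumes "is_h_poly d \<Gamma> h" "k \<le> d"
  shows "(\<Sum>i\<le>d. coeff h i * int ((d - i) choose k)) = int (num_faces \<Gamma> (int (d - k) - 1))"
proof -
  have binom: "coeff ([:1, 1:] ^ n) k = int (n choose k)" for n k
  proof (cases "k \<le> n")
    case False
    have "degree ([:1, 1 :: int:] ^ n) \<le> n" using degree_power_le[of "[:1, 1 :: int:]" n] by simp
    then show ?thesis using False by (simp add: coeff_eq_0 binomial_eq_0)
  qed (simp add: coeff_linear_poly_power)
  have "(\<Sum>i\<le>d. coeff h i * int ((d - i) choose k)) =
      coeff (\<Sum>i\<le>d. smult (coeff h i) ([:1, 1:] ^ (d - i))) k"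
    by (simp add: coeff_sum binom)
  also have "\<dots> = coeff (\<Sum>i\<le>d. monom (int (num_faces \<Gamma> (int i - 1))) (d - i)) k"
    using assms(1) by (simp add: is_h_poly_def)
  also have "\<dots> = (\<Sum>i\<le>d. if i = d - k then int (num_faces \<Gamma> (int i - 1)) else 0)"
    unfolding coeff_sum using assms(2) by (intro sum.cong) auto
  also have "\<dots> = int (num_faces \<Gamma> (int (d - k) - 1))" using assms(2) by simp
  finally show ?thesis .
qed

lemma num_faces_minus_1: "{} \<in> \<Gamma> \<Longrightarrow> num_faces \<Gamma> (-1) = 1"
proof -
  assume "{} \<in> \<Gamma>"
  then have "{S \<in> \<Gamma>. aff_dim S = -1} = {{}}"
    by (auto simp flip: aff_dim_empty)
  then show ?thesis by (simp add: num_faces_def)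
qed

text \<open>The equations for k = d, d - 1, ... form a triangular system for the coefficients. The
  values of \<open>d\<close> are premises so that \<open>d\<close> can be instantiated by a
  cardinality.\<close>

lemma h_poly_coeffs:
  assumes h: "is_h_poly d \<Gamma> h" and empty: "{} \<in> \<Gamma>"
  shows "d = 3 \<Longrightarrow> coeff h 1 = int (num_faces \<Gamma> 0) - 3"
    and "d = 3 \<Longrightarrow> coeff h 2 = int (num_faces \<Gamma> 1) - 2 * int (num_faces \<Gamma> 0) + 3"
    and "d = 3 \<Longrightarrow> coeff h 3 = int (num_faces \<Gamma> 2) - int (num_faces \<Gamma> 1) + int (num_faces \<Gamma> 0) - 1"
    and "d = 2 \<Longrightarrow> coeff h 1 = int (num_faces \<Gamma> 0) - 2"
    and "d = 2 \<Longrightarrow> coeff h 2 = int (num_faces \<Gamma> 1) - int (num_faces \<Gamma> 0) + 1"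
    and "d = 1 \<Longrightarrow> coeff h 1 = int (num_faces \<Gamma> 0) - 1"
    and "d < i \<Longrightarrow> coeff h i = 0"
proof -
  note c = is_h_poly_coeff[OF h] num_faces_minus_1[OF empty]
  note s = eval_nat_numeral binomial_eq_0
  { assume d: "d = 3"
    show "coeff h 1 = int (num_faces \<Gamma> 0) - 3"
      "coeff h 2 = int (num_faces \<Gamma> 1) - 2 * int (num_faces \<Gamma> 0) + 3"
      "coeff h 3 = int (num_faces \<Gamma> 2) - int (num_faces \<Gamma> 1) + int (num_faces \<Gamma> 0) - 1"
      using c(1)[of 3] c(1)[of 2] c(1)[of 1] c(1)[of 0] c(2) unfolding d
      by (simp_all add: s) }
  { assume d: "d = 2"
    show "coeff h 1 = int (num_faces \<Gamma> 0) - 2"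
      "coeff h 2 = int (num_faces \<Gamma> 1) - int (num_faces \<Gamma> 0) + 1"
      using c(1)[of 2] c(1)[of 1] c(1)[of 0] c(2) unfolding d
      by (simp_all add: s) }
  { assume d: "d = 1"
    show "coeff h 1 = int (num_faces \<Gamma> 0) - 1"
      using c(1)[of 1] c(1)[of 0] c(2) unfolding d by (simp_all add: s) }
  show "d < i \<Longrightarrow> coeff h i = 0" using h by (simp add: is_h_poly_def coeff_eq_0)
qed

section \<open>Vertices and edges on a side\<close>

context triangulated_triangle begin

text \<open>Each edge is sent to its end farther from \<open>b\<close>. This is injective because at
  most one edge leaves a vertex in the direction of \<open>b\<close>, and it never takes the value
  \<open>b\<close>.\<close>

lemma card_side_edges_le:
  assumes side: "side b c" and b: "b \<in> vertices \<Gamma>"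
  shows "num_faces (restriction \<Gamma> (closed_segment b c)) 1 + 1
    \<le> num_faces (restriction \<Gamma> (closed_segment b c)) 0"
proof -
  let ?F = "closed_segment b c"
  let ?R = "restriction \<Gamma> ?F"
  define X where "X = {A \<in> face_sets ?R. card A = 2}"
  have R: "simplicial_complex ?R" by (rule complex_restriction[OF complex])
  have sub: "A \<in> face_sets \<Gamma>" "A \<subseteq> ?F" if "A \<in> face_sets ?R" for A
    using that hull_subset[of A convex] by (auto simp: face_sets_def restriction_def)
  have "\<exists>w\<in>A. A \<subseteq> closed_segment w b" if "A \<in> X" for A
  proof -
    obtain u w where uw: "A = {u, w}" using \<open>A \<in> X\<close> by (auto simp: X_def card_2_iff)
    have "A \<subseteq> ?F" using that sub by (simp add: X_def)
    then have "u \<in> closed_segment w b \<or> w \<in> closed_segment u b"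
      using closed_segment_linear uw by blast
    then show ?thesis unfolding uw by auto
  qed
  then obtain far where far: "\<And>A. A \<in> X \<Longrightarrow> far A \<in> A \<and> A \<subseteq> closed_segment (far A) b" by metis
  have other: "\<exists>u. A = {far A, u} \<and> u \<noteq> far A \<and> u \<in> closed_segment (far A) b" if A: "A \<in> X" for A
  proof -
    have "card (A - {far A}) = 1" using A far[OF A] by (simp add: X_def)
    then obtain u where u: "A - {far A} = {u}" by (auto simp: card_1_singleton_iff)
    have "A = insert (far A) (A - {far A})" using far[OF A] by (simp add: insert_absorb)
    then have "A = {far A, u}" unfolding u .
    moreover have "u \<in> A" "u \<noteq> far A" using u by blast+
    ultimately show ?thesis using far[OF A] by blast
  qed
  have "inj_on far X"
  proof (rule inj_onI)
    fix A B assume AB: "A \<in> X" "B \<in> X" "far A = far B"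
    obtain u where u: "A = {far A, u}" "u \<noteq> far A" "u \<in> closed_segment (far A) b"
      using other[OF AB(1)] by blast
    obtain w where w: "B = {far A, w}" "w \<noteq> far A" "w \<in> closed_segment (far A) b"
      using other[OF AB(2)] AB(3) by auto
    have "A \<in> face_sets \<Gamma>" "B \<in> face_sets \<Gamma>" using AB sub by (auto simp: X_def)
    then have "u = w" using ray_unique[of "far A" u w b] u w by simp
    then show "A = B" using u(1) w(1) by simp
  qed
  moreover have "far ` X \<subseteq> vertices ?R - {b}"
  proof
    fix w assume "w \<in> far ` X"
    then obtain A where A: "A \<in> X" "w = far A" by blast
    have "w \<noteq> b" using other[OF A(1)] A(2) by auto
    moreover have "A \<subseteq> vertices ?R" using face_sets_vertices[OF R] A(1) by (simp add: X_def)
    ultimately show "w \<in> vertices ?R - {b}" using far[OF A(1)] A(2) by blast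
  qed
  ultimately have "card X \<le> card (vertices ?R - {b})"
    using finite_vertices[OF R] by (intro card_inj_on_le) auto
  moreover have "b \<in> vertices ?R" using b by (simp add: vertices_def restriction_def)
  moreover then have "card (vertices ?R) > 0" using finite_vertices[OF R] by (auto simp: card_gt_0_iff)
  ultimately have "card X + 1 \<le> card (vertices ?R)"
    using finite_vertices[OF R] by (simp add: card_Diff_singleton)
  moreover have "num_faces ?R 1 = card X" using num_faces_eq[OF R, of 2] by (simp add: X_def)
  ultimately show ?thesis by (simp add: num_faces_0[OF R])
qed

end

section \<open>The coefficients for a triangle\<close>

context triangulated_triangle_corners begin

lemma local_h_poly_eq:
  "local_h_poly (convex hull {a, b, c}) \<Gamma> =
     (\<Sum>A\<in>Pow {a, b, c}. (-1) ^ (3 - card A) * h_poly (convex hull A) (restriction \<Gamma> (convex hull A)))"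
proof -
  have faces: "{F. F face_of convex hull {a, b, c}} = (hull) convex ` Pow {a, b, c}"
    by (auto simp: face_of_convex_hull_affine_independent[OF corners(1)])
  have ind: "\<not> affine_dependent A" if "A \<in> Pow {a, b, c}" for A
    using that affine_independent_subset[OF corners(1)] by blast
  have inj: "inj_on ((hull) convex) (Pow {a, b, c})"
    by (rule inj_onI, rule convex_hull_inj_affine_independent) (use ind in auto)
  have dim: "nat (aff_dim (convex hull {a, b, c}) - aff_dim (convex hull A)) = 3 - card A"
    if "A \<in> Pow {a, b, c}" for A
    using aff_dim_affine_independent[OF ind[OF that]] aff_dim_triangle by (simp add: aff_dim_convex_hull)
  show ?thesis
    unfolding local_h_poly_def faces sum.reindex[OF inj] by (intro sum.cong) (simp_all add: dim)
qed

lemma local_h_poly_zero: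
  assumes zero: "local_h_poly (convex hull {a, b, c}) \<Gamma> = 0"
  shows "vertices \<Gamma> \<subseteq> closed_segment a b \<union> closed_segment b c \<union> closed_segment a c"
    and "card (triangles \<Gamma>) + 2 \<le> card (vertices \<Gamma>)"
proof -
  define h where "h A = h_poly (convex hull A) (restriction \<Gamma> (convex hull A))" for A
  define f where "f A i = int (num_faces (restriction \<Gamma> (convex hull A)) i)" for A i
  have Pow: "Pow {a, b, c} = {{a, b, c}, {a, b}, {b, c}, {a, c}, {a}, {b}, {c}, {}}"
    by (auto simp: Pow_insert)
  \<comment> \<open>These keep the eight summands apart when the sum over the power set is
    expanded.\<close>
  have ne: "{a, b, c} \<noteq> {a, b}" "{a, b, c} \<noteq> {b, c}" "{a, b, c} \<noteq> {a, c}" "{a, b} \<noteq> {b, c}"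
    "{a, b} \<noteq> {a, c}" "{b, c} \<noteq> {a, c}"
    using corners by auto
  have sum: "h {a, b, c} - h {a, b} - h {b, c} - h {a, c} + h {a} + h {b} + h {c} - h {} = 0"
    using zero corners ne unfolding local_h_poly_eq Pow h_def
    by (simp add: insert_eq_iff algebra_simps)
  have empty: "{} \<in> restriction \<Gamma> (convex hull A)" for A
    using triangulates' by (simp add: triangulates_def restriction_def)
  have h: "is_h_poly (card A) (restriction \<Gamma> (convex hull A)) (h A)" if "A \<subseteq> {a, b, c}" for A
  proof -
    have "\<not> affine_dependent A" using affine_independent_subset[OF corners(1) that] .
    then have "nat (aff_dim (convex hull A) + 1) = card A"
      using aff_dim_affine_independent[of A] by (simp add: aff_dim_convex_hull)
    then show ?thesis using is_h_poly_h_poly[of "convex hull A"] by (simp add: h_def)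
  qed
  note hc = h_poly_coeffs[OF h empty]
  have card: "card {a, b, c} = 3" "card {a, b} = 2" "card {b, c} = 2" "card {a, c} = 2" using corners by auto
  have c1: "coeff (h {a, b, c}) 1 = f {a, b, c} 0 - 3" "coeff (h {a, b}) 1 = f {a, b} 0 - 2"
    "coeff (h {b, c}) 1 = f {b, c} 0 - 2" "coeff (h {a, c}) 1 = f {a, c} 0 - 2"
    "coeff (h {a}) 1 = f {a} 0 - 1" "coeff (h {b}) 1 = f {b} 0 - 1" "coeff (h {c}) 1 = f {c} 0 - 1"
    "coeff (h {}) 1 = 0"
    using hc(1)[of "{a, b, c}"] hc(4)[of "{a, b}"] hc(4)[of "{b, c}"] hc(4)[of "{a, c}"]
      hc(6)[of "{a}"] hc(6)[of "{b}"] hc(6)[of "{c}"] hc(7)[of "{}" 1] card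
    by (simp_all add: f_def)
  have c2: "coeff (h {a, b, c}) 2 = f {a, b, c} 1 - 2 * f {a, b, c} 0 + 3"
    "coeff (h {a, b}) 2 = f {a, b} 1 - f {a, b} 0 + 1"
    "coeff (h {b, c}) 2 = f {b, c} 1 - f {b, c} 0 + 1"
    "coeff (h {a, c}) 2 = f {a, c} 1 - f {a, c} 0 + 1"
    "coeff (h {a}) 2 = 0" "coeff (h {b}) 2 = 0" "coeff (h {c}) 2 = 0" "coeff (h {}) 2 = 0"
    using hc(2)[of "{a, b, c}"] hc(5)[of "{a, b}"] hc(5)[of "{b, c}"] hc(5)[of "{a, c}"]
      hc(7)[of "{a}" 2] hc(7)[of "{b}" 2] hc(7)[of "{c}" 2] hc(7)[of "{}" 2] card
    by (simp_all add: f_def)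
  have c3: "coeff (h {a, b, c}) 3 = f {a, b, c} 2 - f {a, b, c} 1 + f {a, b, c} 0 - 1"
    "coeff (h {a, b}) 3 = 0" "coeff (h {b, c}) 3 = 0" "coeff (h {a, c}) 3 = 0"
    "coeff (h {a}) 3 = 0" "coeff (h {b}) 3 = 0" "coeff (h {c}) 3 = 0" "coeff (h {}) 3 = 0"
    using hc(3)[of "{a, b, c}"] hc(7)[of "{a, b}" 3] hc(7)[of "{b, c}" 3] hc(7)[of "{a, c}" 3]
      hc(7)[of "{a}" 3] hc(7)[of "{b}" 3] hc(7)[of "{c}" 3] hc(7)[of "{}" 3] card
    by (simp_all add: f_def)
  have sum_coeff: "coeff (h {a, b, c}) i - coeff (h {a, b}) i - coeff (h {b, c}) i - coeff (h {a, c}) i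
      + coeff (h {a}) i + coeff (h {b}) i + coeff (h {c}) i - coeff (h {}) i = 0" for i
    using arg_cong[OF sum, of "\<lambda>p. coeff p i"] by simp
  have f0: "f A 0 = int (card (vertices \<Gamma> \<inter> convex hull A))" for A
  proof -
    have "vertices (restriction \<Gamma> (convex hull A)) = vertices \<Gamma> \<inter> convex hull A"
      by (auto simp: vertices_def restriction_def)
    then show ?thesis
      by (simp add: f_def num_faces_0[OF complex_restriction[OF complex]])
  qed
  have corner_in: "vertices \<Gamma> \<inter> {x} = {x}" if "x \<in> {a, b, c}" for x using that corners_vertices by blast
  have f01: "f {a} 0 = 1" "f {b} 0 = 1" "f {c} 0 = 1"
    using corner_in by (simp_all add: f0)
  have all: "restriction \<Gamma> (convex hull {a, b, c}) = \<Gamma>"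
    using Union_eq by (auto simp: restriction_def)
  have f_all: "f {a, b, c} 0 = int (card (vertices \<Gamma>))" "f {a, b, c} 2 = int (card (triangles \<Gamma>))"
    by (simp_all add: f_def all num_faces_0[OF complex] num_faces_2[OF complex])
  let ?AB = "vertices \<Gamma> \<inter> closed_segment a b" and ?BC = "vertices \<Gamma> \<inter> closed_segment b c"
    and ?AC = "vertices \<Gamma> \<inter> closed_segment a c"
  note fin = finite_vertices[OF complex]
  \<comment> \<open>In degree one the corners contribute 0, and each side its number of vertices
    minus 2.\<close>
  have eq1: "int (card (vertices \<Gamma>)) + 3 = int (card ?AB) + int (card ?BC) + int (card ?AC)"
    using sum_coeff[of 1] c1 f01 f_all by (simp add: f0 segment_convex_hull)
  have "card ?AB + card ?BC = card (?AB \<union> ?BC) + card (?AB \<inter> ?BC)"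
    using fin by (intro card_Un_Int) auto
  moreover have "?AB \<inter> ?BC = {b}"
    using sides_meet(2) corners_vertices by (auto simp: closed_segment_commute)
  moreover have "card (?AB \<union> ?BC) + card ?AC = card ((?AB \<union> ?BC) \<union> ?AC) + card ((?AB \<union> ?BC) \<inter> ?AC)"
    using fin by (intro card_Un_Int) auto
  moreover have "(?AB \<union> ?BC) \<inter> ?AC = {a, c}"
    using sides_meet(1,3) corners_vertices by (auto simp: closed_segment_commute)
  ultimately have "card ?AB + card ?BC + card ?AC = card ((?AB \<union> ?BC) \<union> ?AC) + 3"
    using corners by simp
  \<comment> \<open>Adding the sides counts each corner twice, which accounts for the 3 in
    \<open>eq1\<close>; so the sides carry as many vertices as there are in all.\<close>
  then have "card ((?AB \<union> ?BC) \<union> ?AC) = card (vertices \<Gamma>)" using eq1 by linarith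
  then have "(?AB \<union> ?BC) \<union> ?AC = vertices \<Gamma>" using fin by (intro card_subset_eq) auto
  then show "vertices \<Gamma> \<subseteq> closed_segment a b \<union> closed_segment b c \<union> closed_segment a c" by blast
  have edges: "f {u, w} 1 - f {u, w} 0 + 1 \<le> 0" if "side u w" "u \<in> {a, b, c}" for u w
    using card_side_edges_le[OF that(1)] that(2) corners_vertices
    by (auto simp: f_def segment_convex_hull)
  have "f {a, b, c} 1 - 2 * f {a, b, c} 0 + 3 \<le> 0"
    using sum_coeff[of 2] c2 edges[OF sides(1)] edges[OF sides(2)] edges[OF sides(3)] by simp
  moreover have "f {a, b, c} 2 - f {a, b, c} 1 + f {a, b, c} 0 - 1 = 0"
    using sum_coeff[of 3] c3 by simp
  ultimately show "card (triangles \<Gamma>) + 2 \<le> card (vertices \<Gamma>)"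
    using f_all by linarith
qed

end

text \<open>Induction on the number of vertices: a mergeable vertex gives a coarser triangulation
  with the same two properties, and the merge undone is the last refinement of the sequence.\<close>

lemma conical_refinement_of_trivial_or_triforce:
  assumes "triangulated_triangle_corners a b c \<Gamma>"
    and "vertices \<Gamma> \<subseteq> closed_segment a b \<union> closed_segment b c \<union> closed_segment a c"
    and "card (triangles \<Gamma>) + 2 \<le> card (vertices \<Gamma>)"
  shows "\<exists>\<Gamma>\<^sub>0. (\<Gamma>\<^sub>0 = trivial_subdivision (convex hull {a, b, c}) \<or>
      triforce_subdivision (convex hull {a, b, c}) \<Gamma>\<^sub>0) \<and>
      (conical_facet_refinement (convex hull {a, b, c}))\<^sup>*\<^sup>* \<Gamma>\<^sub>0 \<Gamma>"
  using assms
proof (induction "card (vertices \<Gamma>)" arbitrary: \<Gamma> rule: less_induct)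
  case less
  interpret triangulated_triangle_corners a b c \<Gamma> by (rule less.prems(1))
  note fin = finite_vertices[OF complex]
  have V: "{a, b, c} \<subseteq> vertices \<Gamma>" by (rule corners_vertices)
  show ?case
  proof (cases "\<exists>v \<in> vertices \<Gamma> - {a, b, c}. card (triangles_at \<Gamma> v) \<le> 2")
    case True
    then obtain v where v: "v \<in> vertices \<Gamma>" "v \<notin> {a, b, c}" "card (triangles_at \<Gamma> v) \<le> 2" by blast
    then have "v \<in> open_segment a b \<or> v \<in> open_segment b c \<or> v \<in> open_segment a c"
      using less.prems(2) by (auto simp: open_segment_def)
    then obtain u w where uw: "side u w" "v \<in> open_segment u w" using sides by blast
    obtain \<Gamma>' where \<Gamma>': "triangulates \<Gamma>' (convex hull {a, b, c})" "vertices \<Gamma>' = vertices \<Gamma> - {v}"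
      "card (triangles \<Gamma>') + 1 \<le> card (triangles \<Gamma>)"
      "conical_facet_refinement (convex hull {a, b, c}) \<Gamma>' \<Gamma>"
      using merge_triangles[OF uw v(1,3)] by metis
    have "card (vertices \<Gamma>) > 0" using v fin by (auto simp: card_gt_0_iff)
    then have card': "card (vertices \<Gamma>') < card (vertices \<Gamma>)" "card (vertices \<Gamma>) = card (vertices \<Gamma>') + 1"
      using v fin by (simp_all add: \<Gamma>'(2) card_Diff_singleton)
    have "triangulated_triangle_corners a b c \<Gamma>'"
      using corners \<Gamma>'(1) by (simp add: triangulated_triangle_corners_def)
    moreover have "vertices \<Gamma>' \<subseteq> closed_segment a b \<union> closed_segment b c \<union> closed_segment a c"
      using \<Gamma>'(2) less.prems(2) by blast
    moreover have "card (triangles \<Gamma>') + 2 \<le> card (vertices \<Gamma>')"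
      using \<Gamma>'(3) less.prems(3) card'(2) by linarith
    ultimately show ?thesis
      using less.hyps[OF card'(1)] \<Gamma>'(4) by (meson rtranclp.rtrancl_into_rtrancl)
  next
    case False
    \<comment> \<open>The least possible number of triangles at a vertex when nothing can be merged.
      These bounds add up to 3 (f_0 - 2), which is at least 3 f_2 by assumption, so each bound is
      attained.\<close>
    define g where "g v = (if v \<in> {a, b, c} then 1 else 3 :: nat)" for v
    have ge: "g v \<le> card (triangles_at \<Gamma> v)" if "v \<in> vertices \<Gamma>" for v
      using that False card_triangles_at_ge_1[OF that] by (force simp: g_def)
    have "sum g (vertices \<Gamma>) = sum g (vertices \<Gamma> - {a, b, c}) + sum g {a, b, c}"
      by (rule sum.subset_diff[OF V fin])
    also have "sum g {a, b, c} = 3" using corners by (simp add: g_def)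
    also have "sum g (vertices \<Gamma> - {a, b, c}) = 3 * card (vertices \<Gamma> - {a, b, c})"
      by (simp add: g_def)
    also have "card (vertices \<Gamma> - {a, b, c}) = card (vertices \<Gamma>) - 3"
      using V corners by (subst card_Diff_subset) auto
    finally have "(\<Sum>v\<in>vertices \<Gamma>. card (triangles_at \<Gamma> v)) \<le> sum g (vertices \<Gamma>)"
      using sum_card_triangles_at less.prems(3) card_mono[OF fin V] corners by simp
    then have "sum g (vertices \<Gamma>) = (\<Sum>v\<in>vertices \<Gamma>. card (triangles_at \<Gamma> v))"
      using sum_mono[of "vertices \<Gamma>" g] ge by (intro antisym) auto
    then have eq: "card (triangles_at \<Gamma> v) = g v" if "v \<in> vertices \<Gamma>" for v
      using sum_mono_inv[of g "vertices \<Gamma>" "\<lambda>v. card (triangles_at \<Gamma> v)" v] ge that fin by simp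
    have corner: "card (triangles_at \<Gamma> a) = 1" "card (triangles_at \<Gamma> b) = 1" "card (triangles_at \<Gamma> c) = 1"
      using V eq by (simp_all add: g_def)
    have "card (triangles_at \<Gamma> v) = 3" if "v \<in> vertices \<Gamma>" "v \<notin> {a, b, c}" for v
      using eq[OF that(1)] that(2) by (simp add: g_def)
    from trivial_or_triforce[OF less.prems(2) corner this]
    have "\<Gamma> = trivial_subdivision (convex hull {a, b, c}) \<or> triforce_subdivision (convex hull {a, b, c}) \<Gamma>"
      by blast
    then show ?thesis by blast
  qed
qed

theorem theorem1p1:
  fixes \<Delta> :: "'a::euclidean_space set" and \<Gamma> :: "'a set set"
  assumes "2 simplex \<Delta>"
    and "triangulates \<Gamma> \<Delta>"
    and "local_h_poly \<Delta> \<Gamma> = 0"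
  shows "\<exists>\<Gamma>\<^sub>0. (\<Gamma>\<^sub>0 = trivial_subdivision \<Delta> \<or> triforce_subdivision \<Delta> \<Gamma>\<^sub>0) \<and>
           (conical_facet_refinement \<Delta>)\<^sup>*\<^sup>* \<Gamma>\<^sub>0 \<Gamma>"
proof -
  obtain C where C: "\<not> affine_dependent C" "int (card C) = 2 + 1" "\<Delta> = convex hull C"
    using assms(1) unfolding simplex_def by blast
  then have "card C = 3" by simp
  then obtain a b c where abc: "C = {a, b, c}" "a \<noteq> b" "b \<noteq> c" "a \<noteq> c"
    by (auto simp: card_Suc_eq numeral_3_eq_3)
  interpret triangulated_triangle_corners a b c \<Gamma>
    using C abc assms(2) by unfold_locales auto
  show ?thesis
    using conical_refinement_of_trivial_or_triforce[OF triangulated_triangle_corners_axioms] local_h_poly_zero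
      assms(3) C(3) abc(1) by simp
qed

end
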